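(* Let $c>0$, let $\nu,\tilde\nu$ be probability measures on $\mathbb R_+$ different from $\boldsymbol d_0$, and let $\delta,\tilde\delta,m,\mu,\rho,\tilde\rho$ be as defined below. For every $x\in\mathbb R_*=\mathbb R\setminus\{0\}$, the limit $m(x):=\lim_{z\in\mathbb C_+\to x}m(z)$ exists; the function $x\mapsto\Im m(x)$ is continuous on $\mathbb R_*$, and $\mu$ has on $\mathbb R_*$ a continuous density $f(x)=\pi^{-1}\Im m(x)$. Similarly, for every $x\in\mathbb R_*$ the limits $\delta(x):=\lim_{z\in\mathbb C_+\to x}\delta(z)$ and $\tilde\delta(x):=\lim_{z\in\mathbb C_+\to x}\tilde\delta(z)$ exist, the functions $\Im\delta(x)$ and $\Im\tilde\delta(x)$ are continuous on $\mathbb R_*$, and $\rho$ and $\tilde\rho$ have continuous densities on $\mathbb R_*$. Finally, $$\operatorname{supp}(\rho)\cap\mathbb R_*=\operatorname{supp}(\tilde\rho)\cap\mathbb R_*=\operatorname{supp}(\mu)\cap\mathbb R_*.$$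
   Context: $\mathbb C_+=\{z:\Im z>0\}$, $\boldsymbol d_0$ is the Dirac mass at $0$. For $z\in\mathbb C_+$, $(\delta(z),\tilde\delta(z))$ is the unique solution in $\mathbb C_+^2$ of $\delta = c\int \frac{t}{-z(1+\tilde\delta t)}\nu(dt)$, $\tilde\delta=\int\frac{t}{-z(1+\delta t)}\tilde\nu(dt)$. The function $m(z)=\int\frac{1}{-z(1+\tilde\delta(z)t)}\nu(dt)$ is the Stieltjes transform $\int\frac{1}{t-z}\mu(dt)$ of a probability measure $\mu$ on $\mathbb R_+$. Moreover $\delta(z)=\int_0^\infty\frac{\rho(dt)}{t-z}$ and $\tilde\delta(z)=\int_0^\infty\frac{\tilde\rho(dt)}{t-z}$ for positive Radon measures $\rho,\tilde\rho$ on $\mathbb R_+$ with $0<\int(1+t)^{-1}\rho(dt)<\infty$, $0<\int(1+t)^{-1}\tilde\rho(dt)<\infty$. The limits $z\in\mathbb C_+\to x$ are limits as $z$ tends to $x$ within $\mathbb C_+$ (the paper calls them nontangential limits). *)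

theory Defs
  imports "HOL-Probability.Probability"
begin

definition upper_half :: "complex set" where
  "upper_half = {z. Im z > 0}"

definition bval :: "(complex \<Rightarrow> complex) \<Rightarrow> real \<Rightarrow> complex" where
  "bval f x = Lim (at (complex_of_real x) within upper_half) f"

definition msupport :: "real measure \<Rightarrow> real set" where
  "msupport M = {x. \<forall>e>0. emeasure M (ball x e) \<noteq> 0}"

definition has_density_on :: "real measure \<Rightarrow> real set \<Rightarrow> (real \<Rightarrow> real) \<Rightarrow> bool" where
  "has_density_on M A g \<longleftrightarrow> (\<forall>x\<in>A. g x \<ge> 0) \<and>
     (\<forall>B\<in>sets borel. B \<subseteq> A \<longrightarrow> emeasure M B = (\<integral>\<^sup>+ x\<in>B. ennreal (g x) \<partial>lborel))"

end

theory Submission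
  imports Defs
begin

text \<open>
  Absorb c into the first measure and write \<open>z\<delta> = - \<integral> a dN\<close> with \<open>a t = t / (1 + \<delta>' t)\<close>, and symmetrically
  for \<open>\<delta>'\<close>. With the energies \<open>A = \<integral> |a|\<^sup>2 dN\<close> and A', taking imaginary parts gives
  \<open>A A' \<le> |z|\<^sup>2\<close> on the upper half-plane.

  \<^emph>\<open>Boundedness away from 0.\<close> The energy bound and the Cauchy-Schwarz inequality bound \<open>z\<delta>\<delta>'\<close> and
  make the two integrands representing it bounded in mean square. If \<open>|\<delta>| \<rightarrow> \<infinity>\<close> then
  \<open>\<delta>' \<rightarrow> 0\<close>, and one representation of \<open>z\<delta>\<delta>'\<close> tends to 0 while the other tends to
  \<open>- N' (0, \<infinity>) \<noteq> 0\<close>.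

  \<^emph>\<open>Uniqueness of cluster values.\<close> Subtracting the equations for two cluster values at x \<noteq> 0 gives
  \<open>S S' = x\<^sup>2\<close> for the mixed integrals \<open>S = \<integral> a\<^sub>1 a\<^sub>2 dN\<close> and S'. Together with the energy bound this
  forces equality in Cauchy-Schwarz, that is \<open>a\<^sub>1 = k cnj a\<^sub>2\<close> asymptotically in mean square.
  Integrating gives \<open>\<delta>\<^sub>1 = k cnj \<delta>\<^sub>2\<close> and \<open>\<delta>'\<^sub>1 = k\<^sup>-\<^sup>1 cnj \<delta>'\<^sub>2\<close>; substituting back gives k = 1, so both
  values are real and equal.

  The statements on m follow from \<open>m = - 1 / z - \<delta>\<delta>' / c\<close>, the densities from Stieltjes inversion,
  and the equality of the supports from two-sided comparisons between the boundary imaginary parts.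
\<close>

section \<open>Boundary values and Stieltjes inversion\<close>

lemma tendsto_Complex_vertical: "(\<lambda>n. Complex x (inverse (real (Suc n)))) \<longlonglongrightarrow> of_real x"
  using tendsto_Complex[OF tendsto_const LIMSEQ_inverse_real_of_nat, of x]
  by (simp add: complex_of_real_def)

lemma tendsto_along_upper_half:
  assumes "(f \<longlongrightarrow> l) (at (complex_of_real x) within upper_half)"
    and "\<And>n. Im (z n) > 0" "z \<longlonglongrightarrow> of_real x"
  shows "(\<lambda>n. f (z n)) \<longlonglongrightarrow> l"
proof -
  have "z n \<in> upper_half - {of_real x}" for n using assms(2)[of n] by (auto simp: upper_half_def)
  then show ?thesis using assms(1,3) unfolding tendsto_at_iff_sequentially o_def by blast
qed

text \<open>Nontriviality of this filter makes limits within \<open>upper_half\<close> unique, so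
  \<open>bval\<close>, which is defined through \<open>Lim\<close>, returns the limit whenever one
  exists.\<close>

lemma at_within_upper_half_nontrivial: "at (complex_of_real x) within upper_half \<noteq> bot"
proof -
  have "Complex x (inverse (real (Suc n))) \<in> upper_half - {of_real x}" for n
    by (auto simp: upper_half_def complex_eq_iff)
  then have "complex_of_real x islimpt upper_half"
    unfolding islimpt_sequential
    using tendsto_Complex_vertical by (intro exI[of _ "\<lambda>n. Complex x (inverse (real (Suc n)))"]) simp
  then show ?thesis by (simp add: trivial_limit_within)
qed

lemma tendsto_bval:
  assumes "\<exists>L. (f \<longlongrightarrow> L) (at (complex_of_real x) within upper_half)"
  shows "(f \<longlongrightarrow> bval f x) (at (complex_of_real x) within upper_half)"
  unfolding bval_def using assms tendsto_Lim[OF at_within_upper_half_nontrivial] by blast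

text \<open>An estimate for \<open>dist (f z) (L x)\<close> on a half-disc about x passes to the
  boundary values at the real points y of that disc by approaching y vertically. Pointwise limits
  thus suffice for continuity.\<close>

lemma continuous_on_boundary_values:
  fixes f :: "complex \<Rightarrow> 'a::metric_space"
  assumes lim: "\<And>x. x \<in> U \<Longrightarrow> (f \<longlongrightarrow> L x) (at (complex_of_real x) within upper_half)"
  shows "continuous_on U L"
proof (rule continuous_on_iff[THEN iffD2], intro ballI allI impI)
  fix x e :: real assume x: "x \<in> U" and e: "e > 0"
  \<comment> \<open>The bound \<open>e / 2\<close> leaves room for a strict inequality after a
    passage to the limit, which preserves only \<le>.\<close>
  have "\<forall>\<^sub>F z in at (complex_of_real x) within upper_half. dist (f z) (L x) < e / 2"
    using tendstoD[OF lim[OF x], of "e / 2"] e by simp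
  then obtain d where d: "d > 0"
    "\<And>z. z \<in> upper_half \<Longrightarrow> z \<noteq> of_real x \<Longrightarrow> dist z (of_real x) < d \<Longrightarrow> dist (f z) (L x) < e / 2"
    unfolding eventually_at by blast
  show "\<exists>d>0. \<forall>y\<in>U. dist y x < d \<longrightarrow> dist (L y) (L x) < e"
  proof (intro exI conjI ballI impI)
    fix y assume y: "y \<in> U" "dist y x < d"
    let ?z = "\<lambda>n. Complex y (inverse (real (Suc n)))"
    have "(\<lambda>n. dist (?z n) (of_real x)) \<longlonglongrightarrow> dist (complex_of_real y) (of_real x)"
      by (intro tendsto_intros tendsto_Complex_vertical)
    moreover have "dist (complex_of_real y) (of_real x) < d"
      using y(2) by (simp add: dist_norm flip: of_real_diff)
    ultimately have "\<forall>\<^sub>F n in sequentially. dist (?z n) (of_real x) < d" by (rule order_tendstoD)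
    then have "\<forall>\<^sub>F n in sequentially. dist (f (?z n)) (L x) \<le> e / 2"
      by eventually_elim (rule less_imp_le[OF d(2)], auto simp: upper_half_def complex_eq_iff)
    moreover have "(\<lambda>n. dist (f (?z n)) (L x)) \<longlonglongrightarrow> dist (L y) (L x)"
      by (intro tendsto_intros tendsto_along_upper_half[OF lim[OF y(1)] _ tendsto_Complex_vertical]) simp
    ultimately have "dist (L y) (L x) \<le> e / 2"
      by (intro tendsto_upperbound[OF _ _ sequentially_bot]) auto
    then show "dist (L y) (L x) < e" using e by simp
  qed (fact d)
qed

text \<open>Supplies the dominating constant for Stieltjes inversion on a compact interval. If no
  bound held, there would be points of height at most 1 / (N + 1) with values above N; a subsequence
  converges to a point of [a, b], where the existing limit makes the values bounded.\<close>

lemma bounded_near_boundary: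
  fixes L :: "real \<Rightarrow> complex"
  assumes lim: "\<And>x. x \<in> {a..b} \<Longrightarrow> (f \<longlongrightarrow> L x) (at (complex_of_real x) within upper_half)"
  obtains N K where "\<And>n x. n \<ge> N \<Longrightarrow> x \<in> {a..b} \<Longrightarrow> norm (f (Complex x (inverse (real (Suc n))))) \<le> K"
proof (rule ccontr)
  assume no: "\<not> thesis"
  have "\<exists>n x. n \<ge> N \<and> x \<in> {a..b} \<and> real N < norm (f (Complex x (inverse (real (Suc n)))))" for N
  proof (rule ccontr)
    assume "\<not> ?thesis"
    then have thesis by (intro that[of N "real N"]) (auto simp: not_less)
    with no show False by simp
  qed
  then have "\<forall>N. \<exists>p. fst p \<ge> N \<and> snd p \<in> {a..b} \<and> real N < norm (f (Complex (snd p) (inverse (real (Suc (fst p))))))"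
    by simp
  then obtain p where p: "\<forall>N. fst (p N) \<ge> N \<and> snd (p N) \<in> {a..b}
      \<and> real N < norm (f (Complex (snd (p N)) (inverse (real (Suc (fst (p N)))))))"
    by (rule choice[THEN exE])
  have "seq_compact {a..b}" using compact_Icc compact_imp_seq_compact by blast
  then obtain x s where x: "x \<in> {a..b}" and s: "strict_mono s" "((\<lambda>N. snd (p N)) \<circ> s) \<longlonglongrightarrow> x"
    using p by (elim seq_compactE[of _ "\<lambda>N. snd (p N)"]) auto
  define z where "z N = Complex (snd (p (s N))) (inverse (real (Suc (fst (p (s N))))))" for N
  \<comment> \<open>As the index grows at least as fast as N, the heights tend to 0 along the
    subsequence.\<close>
  have N_le: "N \<le> fst (p (s N))" for N using p seq_suble[OF s(1), of N] order_trans by blast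
  have inv: "(\<lambda>N. inverse (real (Suc (fst (p (s N)))))) \<longlonglongrightarrow> 0"
  proof (rule Lim_null_comparison[OF always_eventually[OF allI] LIMSEQ_inverse_real_of_nat])
    show "norm (inverse (real (Suc (fst (p (s N)))))) \<le> inverse (real (Suc N))" for N
      using N_le[of N] by (simp add: inverse_le_iff_le)
  qed
  have "z \<longlonglongrightarrow> Complex x 0"
    unfolding z_def using s(2) by (intro tendsto_Complex inv) (simp add: o_def)
  then have "z \<longlonglongrightarrow> of_real x" by (simp add: complex_of_real_def)
  then have "(\<lambda>N. f (z N)) \<longlonglongrightarrow> L x"
    by (rule tendsto_along_upper_half[OF lim[OF x], rotated]) (simp add: z_def)
  then have "Bseq (\<lambda>N. f (z N))" by (intro convergent_imp_Bseq convergentI)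
  then obtain K where K: "\<And>N. norm (f (z N)) \<le> K" by (auto simp: Bseq_def)
  obtain N where N: "K < real N" using reals_Archimedean2 by blast
  also have "real N \<le> real (s N)" using seq_suble[OF s(1), of N] by simp
  also have "\<dots> < norm (f (z N))" using p by (simp add: z_def)
  finally show False using K[of N] by simp
qed

section \<open>The Poisson kernel and its arctangent primitive\<close>

lemma DERIV_arctan_shift:
  assumes "e > 0"
  shows "((\<lambda>x. arctan ((x - t) / e)) has_real_derivative e / ((t - x)\<^sup>2 + e\<^sup>2)) (at x)"
proof -
  have "((\<lambda>x. arctan ((x - t) / e)) has_real_derivative inverse (1 + ((x - t) / e)\<^sup>2) * (1 / e)) (at x)"
    using assms by (auto intro!: derivative_eq_intros)
  moreover have "inverse (1 + ((x - t) / e)\<^sup>2) * (1 / e) = e / ((t - x)\<^sup>2 + e\<^sup>2)"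
  proof -
    have "1 + ((x - t) / e)\<^sup>2 = ((t - x)\<^sup>2 + e\<^sup>2) / e\<^sup>2"
      using assms by (simp add: power_divide add_divide_distrib power2_commute)
    then show ?thesis using assms by (simp add: power2_eq_square)
  qed
  ultimately show ?thesis by simp
qed

text \<open>A domination uniform in the height e, by the weight that
  \<open>stieltjes_transform\<close> assumes integrable. For bounded t the increment is at most pi;
  for large t the mean value theorem turns it into (b - a) times a kernel bounded by a constant over
  t^2.\<close>

lemma arctan_window_bound:
  assumes ab: "a \<le> b"
  obtains C where "\<And>e t. 0 < e \<Longrightarrow> e \<le> 1 \<Longrightarrow> arctan ((b - t) / e) - arctan ((a - t) / e) \<le> C * (1 / (1 + \<bar>t\<bar>))"
proof
  \<comment> \<open>\<open>R\<close> is at least 1 and bounds every y between a and b, so |t| > 2 R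
    gives |t - y| \<ge> |t| / 2 as well as 1 + |t| \<le> t^2.\<close>
  define R where "R = \<bar>a\<bar> + \<bar>b\<bar> + 1"
  fix e t :: real assume e: "0 < e" "e \<le> 1"
  let ?h = "arctan ((b - t) / e) - arctan ((a - t) / e)"
  have R1: "R \<ge> 1" by (simp add: R_def)
  show "?h \<le> (pi * (1 + 2 * R) + 4 * (b - a)) * (1 / (1 + \<bar>t\<bar>))"
  proof (cases "\<bar>t\<bar> \<le> 2 * R")
    case True
    have "?h \<le> pi" using arctan_ubound[of "(b - t) / e"] arctan_lbound[of "(a - t) / e"] by simp
    then have "?h * (1 + \<bar>t\<bar>) \<le> pi * (1 + 2 * R)" using True by (intro mult_mono) auto
    also have "\<dots> \<le> pi * (1 + 2 * R) + 4 * (b - a)" using ab by simp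
    finally show ?thesis by (simp add: pos_le_divide_eq)
  next
    case False
    have "?h * (1 + \<bar>t\<bar>) \<le> 4 * (b - a)"
    proof (cases "a = b")
      case ne: False
      then have "a < b" using ab by simp
      from MVT2[OF this DERIV_arctan_shift[OF e(1), of t]]
      obtain y where y: "a < y" "y < b" "?h = (b - a) * (e / ((t - y)\<^sup>2 + e\<^sup>2))" by blast
      have "\<bar>y\<bar> \<le> R" using y by (auto simp: R_def)
      then have "\<bar>t\<bar> / 2 \<le> \<bar>t - y\<bar>" using False by linarith
      then have "(\<bar>t\<bar> / 2)\<^sup>2 \<le> \<bar>t - y\<bar>\<^sup>2" by (intro power_mono) auto
      then have "t\<^sup>2 / 4 \<le> (t - y)\<^sup>2" by (simp add: power_divide)
      moreover have "1 + \<bar>t\<bar> \<le> t\<^sup>2"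
      proof -
        have "1 + \<bar>t\<bar> \<le> 2 * \<bar>t\<bar>" using False R1 by linarith
        also have "\<dots> \<le> \<bar>t\<bar> * \<bar>t\<bar>" using False R1 by (intro mult_right_mono) auto
        finally show ?thesis by (simp add: power2_eq_square)
      qed
      ultimately have le: "1 + \<bar>t\<bar> \<le> 4 * ((t - y)\<^sup>2 + e\<^sup>2)" using zero_le_power2[of e] by (simp only: distrib_left)
      have "e * (1 + \<bar>t\<bar>) \<le> 1 * (4 * ((t - y)\<^sup>2 + e\<^sup>2))" using e le by (intro mult_mono) auto
      moreover have "(t - y)\<^sup>2 + e\<^sup>2 > 0" using e by (simp add: add_nonneg_pos)
      ultimately have "e / ((t - y)\<^sup>2 + e\<^sup>2) * (1 + \<bar>t\<bar>) \<le> 4"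
        by (simp add: divide_simps)
      then have "(b - a) * (e / ((t - y)\<^sup>2 + e\<^sup>2) * (1 + \<bar>t\<bar>)) \<le> (b - a) * 4"
        using ab by (intro mult_left_mono) auto
      then show ?thesis unfolding y(3) by (simp add: mult.assoc)
    qed simp
    also have "\<dots> \<le> pi * (1 + 2 * R) + 4 * (b - a)" using R1 by simp
    finally show ?thesis by (simp add: pos_le_divide_eq)
  qed
qed

text \<open>Pointwise limit of the arctangent terms. Their differences tend to pi inside the window,
  to 0 outside, and to pi / 2 at the end points of a nondegenerate window.\<close>

lemma tendsto_arctan_mult_nat:
  "(\<lambda>n. arctan (s * real (Suc n))) \<longlonglongrightarrow> (if s > 0 then pi / 2 else if s < 0 then - (pi / 2) else 0)"
proof -
  have "(\<lambda>n. arctan (s * real (Suc n))) \<longlonglongrightarrow> pi / 2" if "s > 0" for s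
    using that by (intro filterlim_compose[OF tendsto_arctan_at_top]
      filterlim_tendsto_pos_mult_at_top[OF tendsto_const] filterlim_compose[OF filterlim_real_sequentially filterlim_Suc])
  from this[of s] tendsto_minus[OF this[of "- s"]] show ?thesis
    by (cases s "0 :: real" rule: linorder_cases) (auto simp: arctan_minus simp del: of_nat_Suc)
qed

section \<open>Stieltjes inversion for measures finite on compact sets\<close>

locale stieltjes_transform =
  fixes M :: "real measure" and f :: "complex \<Rightarrow> complex"
  assumes sets_M [measurable_cong, simp]: "sets M = sets borel"
    and compact_finite: "\<And>K. compact K \<Longrightarrow> emeasure M K < \<infinity>"
    and integrable_weight: "integrable M (\<lambda>t. 1 / (1 + \<bar>t\<bar>))"
    and f_eq: "\<And>z. Im z > 0 \<Longrightarrow> f z = (\<integral>t. 1 / (of_real t - z) \<partial>M)"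
begin

lemma space_M [simp]: "space M = UNIV"
  using sets_eq_imp_space_eq[OF sets_M] by simp

lemma sigma_finite: "sigma_finite_measure M"
proof
  have "(\<Union>n::nat. {- real n..real n}) = UNIV"
  proof (intro set_eqI iffI UNIV_I)
    fix x :: real
    obtain n where "\<bar>x\<bar> \<le> real n" using real_arch_simple by blast
    then show "x \<in> (\<Union>n::nat. {- real n..real n})" by (auto simp: abs_le_iff intro!: exI[of _ n])
  qed
  then show "\<exists>A. countable A \<and> A \<subseteq> sets M \<and> \<Union>A = space M \<and> (\<forall>a\<in>A. emeasure M a \<noteq> \<infinity>)"
    using compact_finite[OF compact_Icc]
    by (intro exI[of _ "range (\<lambda>n::nat. {- real n..real n})"]) (auto simp: less_top)
qed

lemma integrable_kernel:
  assumes z: "Im z > 0"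
  shows "integrable M (\<lambda>t. 1 / (of_real t - z))"
proof (rule Bochner_Integration.integrable_bound)
  \<comment> \<open>From |t - z| \<ge> Im z and |t| \<le> |t - z| + |z| one gets 1 + |t| \<le>
    \<open>?C\<close> |t - z|; the summand with the quotient absorbs the constant 1 + |z|.\<close>
  let ?C = "1 + (1 + norm z) / Im z"
  show "integrable M (\<lambda>t. ?C * (1 / (1 + \<bar>t\<bar>)))"
    by (intro integrable_mult_right integrable_weight)
  show "AE t in M. norm (1 / (of_real t - z)) \<le> norm (?C * (1 / (1 + \<bar>t\<bar>)))"
  proof (intro AE_I2)
    fix t
    have ge: "Im z \<le> norm (of_real t - z)" using abs_Im_le_cmod[of "of_real t - z"] z by simp
    have "\<bar>t\<bar> \<le> norm (of_real t - z) + norm z"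
      using norm_triangle_ineq[of "of_real t - z" z] by simp
    moreover have "1 + norm z \<le> (1 + norm z) / Im z * norm (of_real t - z)"
    proof -
      have "(1 + norm z) / Im z * Im z \<le> (1 + norm z) / Im z * norm (of_real t - z)"
        using ge z by (intro mult_left_mono) auto
      then show ?thesis using z by simp
    qed
    moreover have "?C * norm (of_real t - z) = norm (of_real t - z) + (1 + norm z) / Im z * norm (of_real t - z)"
      by (simp only: distrib_right mult_1_left)
    ultimately have "1 + \<bar>t\<bar> \<le> ?C * norm (of_real t - z)" by linarith
    moreover have "norm (of_real t - z) > 0" using ge z by linarith
    moreover have "1 / q \<le> c * (1 / p)" if "p \<le> c * q" "q > 0" "p > 0" for p q c :: real
      using that by (simp add: divide_simps mult.commute)
    ultimately have "1 / norm (of_real t - z) \<le> ?C * (1 / (1 + \<bar>t\<bar>))" by simp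
    moreover have "0 \<le> ?C * (1 / (1 + \<bar>t\<bar>))" using z by simp
    ultimately show "norm (1 / (of_real t - z)) \<le> norm (?C * (1 / (1 + \<bar>t\<bar>)))"
      by (simp only: norm_divide real_norm_def abs_of_nonneg norm_one)
  qed
qed measurable

lemma Im_kernel: "Im (1 / (of_real t - Complex x e)) = e / ((t - x)\<^sup>2 + e\<^sup>2)"
  by (simp add: Im_divide complex_norm power2_eq_square)

lemma integrable_poisson:
  assumes "e > 0" shows "integrable M (\<lambda>t. e / ((t - x)\<^sup>2 + e\<^sup>2))"
  using integrable_Im[OF integrable_kernel[of "Complex x e"]] assms by (simp add: Im_kernel)

lemma Im_eq_poisson:
  assumes "e > 0" shows "Im (f (Complex x e)) = (\<integral>t. e / ((t - x)\<^sup>2 + e\<^sup>2) \<partial>M)"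
proof -
  have "Im (f (Complex x e)) = (\<integral>t. Im (1 / (of_real t - Complex x e)) \<partial>M)"
    using assms integrable_kernel[of "Complex x e"] by (subst f_eq) (simp_all only: complex.sel integral_Im)
  then show ?thesis by (simp only: Im_kernel)
qed

lemma nn_integral_poisson:
  assumes "e > 0"
  shows "(\<integral>\<^sup>+t. ennreal (e / ((t - x)\<^sup>2 + e\<^sup>2)) \<partial>M) = ennreal (Im (f (Complex x e)))"
  unfolding Im_eq_poisson[OF assms]
  using assms by (intro nn_integral_eq_integral integrable_poisson AE_I2) auto

text \<open>An atom at x would make \<open>Im f\<close> grow like 1 / e at height e: e times the
  Poisson kernel is 1 at t = x and nonnegative elsewhere, so the mass of \<open>{x}\<close> is at
  most e times a convergent quantity.\<close>

lemma null_singleton: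
  assumes lim: "(f \<longlongrightarrow> l) (at (complex_of_real x) within upper_half)"
  shows "emeasure M {x} = 0"
proof -
  let ?e = "\<lambda>n. inverse (real (Suc n))"
  have fin: "emeasure M {x} < \<infinity>" using compact_finite[of "{x}"] by simp
  have "measure M {x} \<le> ?e n * Im (f (Complex x (?e n)))" for n
  proof -
    have "(\<integral>t. indicator {x} t \<partial>M) \<le> (\<integral>t. ?e n * (?e n / ((t - x)\<^sup>2 + (?e n)\<^sup>2)) \<partial>M)"
    proof (rule integral_mono)
      show "integrable M (indicator {x} :: real \<Rightarrow> real)" using fin by (simp add: integrable_indicator_iff)
      show "integrable M (\<lambda>t. ?e n * (?e n / ((t - x)\<^sup>2 + (?e n)\<^sup>2)))"
        by (intro integrable_mult_right integrable_poisson) simp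
      show "indicator {x} t \<le> ?e n * (?e n / ((t - x)\<^sup>2 + (?e n)\<^sup>2))" for t
        by (auto simp: indicator_def power2_eq_square simp del: of_nat_Suc)
    qed
    also have "\<dots> = ?e n * (\<integral>t. ?e n / ((t - x)\<^sup>2 + (?e n)\<^sup>2) \<partial>M)"
      by (rule integral_mult_right_zero)
    also have "(\<integral>t. ?e n / ((t - x)\<^sup>2 + (?e n)\<^sup>2) \<partial>M) = Im (f (Complex x (?e n)))"
      by (rule Im_eq_poisson[symmetric]) simp
    finally show ?thesis by simp
  qed
  moreover have "(\<lambda>n. ?e n * Im (f (Complex x (?e n)))) \<longlonglongrightarrow> 0 * Im l"
    by (intro tendsto_intros LIMSEQ_inverse_real_of_nat
        tendsto_along_upper_half[OF lim _ tendsto_Complex_vertical]) simp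
  ultimately have "measure M {x} \<le> 0 * Im l" by (intro LIMSEQ_le_const) auto
  then have "measure M {x} = 0" using measure_nonneg[of M "{x}"] by simp
  then show ?thesis using fin by (auto simp: measure_def enn2real_eq_0_iff)
qed

text \<open>Tonelli exchanges the two integrations of the Poisson kernel, and the inner one over the
  interval is an arctangent increment.\<close>

lemma nn_integral_Im_interval:
  assumes ab: "a \<le> b" and e: "e > 0"
  shows "(\<integral>\<^sup>+x. ennreal (Im (f (Complex x e))) * indicator {a..b} x \<partial>lborel)
    = (\<integral>\<^sup>+t. ennreal (arctan ((b - t) / e) - arctan ((a - t) / e)) \<partial>M)"
proof -
  interpret M: sigma_finite_measure M by (rule sigma_finite)
  interpret P: pair_sigma_finite lborel M ..
  let ?F = "\<lambda>x t. ennreal (e / ((t - x)\<^sup>2 + e\<^sup>2)) * indicator {a..b} x"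
  have "(\<integral>\<^sup>+t. (\<integral>\<^sup>+x. ?F x t \<partial>lborel) \<partial>M) = (\<integral>\<^sup>+x. (\<integral>\<^sup>+t. ?F x t \<partial>M) \<partial>lborel)"
    by (rule P.Fubini') measurable
  moreover have "(\<integral>\<^sup>+t. ?F x t \<partial>M) = ennreal (Im (f (Complex x e))) * indicator {a..b} x" for x
    by (subst nn_integral_multc) (simp_all add: nn_integral_poisson[OF e])
  moreover have "(\<integral>\<^sup>+x. ?F x t \<partial>lborel) = ennreal (arctan ((b - t) / e) - arctan ((a - t) / e))" for t
    using e ab by (intro nn_integral_FTC_Icc DERIV_arctan_shift) auto
  ultimately show ?thesis by simp
qed

text \<open>Let the height tend to 0 in \<open>nn_integral_Im_interval\<close>. Both sides converge
  by dominated convergence, the left with a constant bound, the right with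
  \<open>arctan_window_bound\<close>.\<close>

lemma emeasure_Icc_boundary:
  assumes ab: "a \<le> b"
    and lim: "\<And>x. x \<in> {a..b} \<Longrightarrow> (f \<longlongrightarrow> L x) (at (complex_of_real x) within upper_half)"
  shows "ennreal pi * emeasure M {a..b} = (\<integral>\<^sup>+x. ennreal (Im (L x)) * indicator {a..b} x \<partial>lborel)"
proof -
  obtain N K where NK: "\<And>n x. n \<ge> N \<Longrightarrow> x \<in> {a..b} \<Longrightarrow> norm (f (Complex x (inverse (real (Suc n))))) \<le> K"
    using bounded_near_boundary[OF lim] by blast
  \<comment> \<open>The shift by N puts every height in the range where the bound K holds.\<close>
  define e where "e n = inverse (real (Suc (n + N)))" for n
  have e: "e n > 0" "e n \<le> 1" for n by (simp_all add: e_def inverse_le_1_iff del: of_nat_Suc)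
  have e0: "e \<longlonglongrightarrow> 0"
    using LIMSEQ_ignore_initial_segment[OF LIMSEQ_inverse_real_of_nat, of N] unfolding e_def .
  let ?h = "\<lambda>n t. arctan ((b - t) / e n) - arctan ((a - t) / e n)"
  have cont: "continuous_on {a..b} (\<lambda>x. Im (L x))"
    using lim by (intro continuous_intros continuous_on_boundary_values)
  have "(\<lambda>x. ennreal (indicator {a..b} x *\<^sub>R Im (L x))) \<in> borel_measurable borel"
    using cont by (intro measurable_compose[OF borel_measurable_continuous_on_indicator measurable_ennreal]) auto
  also have "(\<lambda>x. ennreal (indicator {a..b} x *\<^sub>R Im (L x))) = (\<lambda>x. ennreal (Im (L x)) * indicator {a..b} x)"
    by (auto simp: indicator_def)
  finally have meas_L: "(\<lambda>x. ennreal (Im (L x)) * indicator {a..b} x) \<in> borel_measurable borel" .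
  have meas_f: "(\<lambda>x. ennreal (Im (f (Complex x (e n)))) * indicator {a..b} x) \<in> borel_measurable borel" for n
  proof -
    interpret M: sigma_finite_measure M by (rule sigma_finite)
    show ?thesis unfolding nn_integral_poisson[OF e(1), symmetric] by measurable
  qed
  have lhs: "(\<lambda>n. \<integral>\<^sup>+x. ennreal (Im (f (Complex x (e n)))) * indicator {a..b} x \<partial>lborel)
      \<longlonglongrightarrow> (\<integral>\<^sup>+x. ennreal (Im (L x)) * indicator {a..b} x \<partial>lborel)"
  proof (rule nn_integral_dominated_convergence[where w = "\<lambda>x. ennreal K * indicator {a..b} x"])
    show "AE x in lborel. ennreal (Im (f (Complex x (e n)))) * indicator {a..b} x \<le> ennreal K * indicator {a..b} x" for n
    proof (intro AE_I2)
      fix x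
      show "ennreal (Im (f (Complex x (e n)))) * indicator {a..b} x \<le> ennreal K * indicator {a..b} x"
      proof (cases "x \<in> {a..b}")
        case True
        then have "Im (f (Complex x (e n))) \<le> K"
          using NK[of "n + N" x] abs_Im_le_cmod[of "f (Complex x (e n))"] by (simp add: e_def)
        then show ?thesis by (intro mult_right_mono ennreal_leI) auto
      qed simp
    qed
    show "(\<integral>\<^sup>+x. ennreal K * indicator {a..b} x \<partial>lborel) < \<infinity>"
      using ab by (simp add: nn_integral_cmult_indicator ennreal_mult_less_top)
    show "AE x in lborel. (\<lambda>n. ennreal (Im (f (Complex x (e n)))) * indicator {a..b} x)
        \<longlonglongrightarrow> ennreal (Im (L x)) * indicator {a..b} x"
    proof (intro AE_I2)
      fix x
      show "(\<lambda>n. ennreal (Im (f (Complex x (e n)))) * indicator {a..b} x) \<longlonglongrightarrow> ennreal (Im (L x)) * indicator {a..b} x"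
      proof (cases "x \<in> {a..b}")
        case True
        have "(\<lambda>n. Complex x (e n)) \<longlonglongrightarrow> Complex x 0" by (intro tendsto_Complex e0 tendsto_const)
        then have "(\<lambda>n. Complex x (e n)) \<longlonglongrightarrow> of_real x" by (simp add: complex_of_real_def)
        from tendsto_along_upper_half[OF lim[OF True] _ this]
        have "(\<lambda>n. f (Complex x (e n))) \<longlonglongrightarrow> L x" using e by simp
        from tendsto_ennrealI[OF tendsto_Im[OF this]] show ?thesis using True by simp
      qed simp
    qed
  qed (use meas_L meas_f in auto)
  have rhs: "(\<lambda>n. \<integral>\<^sup>+t. ennreal (?h n t) \<partial>M) \<longlonglongrightarrow> (\<integral>\<^sup>+t. ennreal pi * indicator {a..b} t \<partial>M)"
  proof -
    obtain C where C: "\<And>e t. 0 < e \<Longrightarrow> e \<le> 1 \<Longrightarrow> arctan ((b - t) / e) - arctan ((a - t) / e) \<le> C * (1 / (1 + \<bar>t\<bar>))"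
      using arctan_window_bound[OF ab] by blast
    show ?thesis
    proof (rule nn_integral_dominated_convergence[where w = "\<lambda>t. ennreal (C * (1 / (1 + \<bar>t\<bar>)))"])
      show "AE t in M. ennreal (?h n t) \<le> ennreal (C * (1 / (1 + \<bar>t\<bar>)))" for n
        by (intro AE_I2 ennreal_leI C e)
      show "(\<integral>\<^sup>+t. ennreal (C * (1 / (1 + \<bar>t\<bar>))) \<partial>M) < \<infinity>"
        using integrableD(2)[OF integrable_mult_right[OF integrable_weight, of C]] by (simp add: less_top)
      \<comment> \<open>At the end points the arctangent increments need not tend to pi; these
        points carry no mass by \<open>null_singleton\<close>.\<close>
      have "{a, b} \<in> null_sets M"
      proof -
        have "{a} \<in> null_sets M" "{b} \<in> null_sets M"
          using null_singleton[OF lim[of a]] null_singleton[OF lim[of b]] ab by (auto simp: null_sets_def)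
        then have "{a} \<union> {b} \<in> null_sets M" by (rule null_sets.Un)
        then show ?thesis by (simp add: insert_commute)
      qed
      then have "AE t in M. t \<notin> {a, b}" by (rule AE_not_in)
      then show "AE t in M. (\<lambda>n. ennreal (?h n t)) \<longlonglongrightarrow> ennreal pi * indicator {a..b} t"
      proof eventually_elim
        case (elim t)
        have l: "(\<lambda>n. arctan (s / e n)) \<longlonglongrightarrow> (if s > 0 then pi / 2 else if s < 0 then - (pi / 2) else 0)" for s
          using LIMSEQ_ignore_initial_segment[OF tendsto_arctan_mult_nat[of s], of N]
          by (simp add: e_def divide_inverse del: of_nat_Suc)
        have "(\<lambda>n. ?h n t) \<longlonglongrightarrow> pi * indicator {a..b} t"
          using tendsto_diff[OF l[of "b - t"] l[of "a - t"]] elim ab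
          by (auto simp: indicator_def split: if_splits)
        from tendsto_ennrealI[OF this] show ?case by (simp add: ennreal_mult' flip: ennreal_indicator)
      qed
    qed measurable
  qed
  have "ennreal pi * emeasure M {a..b} = (\<integral>\<^sup>+t. ennreal pi * indicator {a..b} t \<partial>M)"
    by (rule nn_integral_cmult_indicator[symmetric]) simp
  also have "\<dots> = (\<integral>\<^sup>+x. ennreal (Im (L x)) * indicator {a..b} x \<partial>lborel)"
    using rhs lhs[unfolded nn_integral_Im_interval[OF ab e(1)]] by (rule LIMSEQ_unique)
  finally show ?thesis .
qed

lemma Im_nonneg: "Im z > 0 \<Longrightarrow> Im (f z) \<ge> 0"
  using Im_eq_poisson[of "Im z" "Re z"] by (simp add: Bochner_Integration.integral_nonneg)

lemma Im_boundary_nonneg: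
  assumes "(f \<longlongrightarrow> l) (at (complex_of_real x) within upper_half)"
  shows "Im l \<ge> 0"
proof (rule LIMSEQ_le_const[OF tendsto_Im[OF tendsto_along_upper_half[OF assms _ tendsto_Complex_vertical]]])
  show "\<exists>N. \<forall>n\<ge>N. 0 \<le> Im (f (Complex x (inverse (real (Suc n)))))"
    by (intro exI allI impI Im_nonneg) simp
qed simp

text \<open>Both sides are measures in B. Restricted to [a, b] they are compared on the half-lines
  \<open>{y<..}\<close>, where the claim reduces to \<open>emeasure_Icc_boundary\<close> on
  intervals ending at b.\<close>

lemma emeasure_subset_Icc_boundary:
  assumes lim: "\<And>x. x \<in> {a..b} \<Longrightarrow> (f \<longlongrightarrow> L x) (at (complex_of_real x) within upper_half)"
    and B: "B \<in> sets borel" "B \<subseteq> {a..b}"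
  shows "emeasure M B = (\<integral>\<^sup>+x. ennreal (Im (L x) / pi) * indicator B x \<partial>lborel)"
proof (cases "a \<le> b")
  case True
  \<comment> \<open>The indicator is built into \<open>g\<close> because continuity of L, hence
    measurability, is known only on the interval.\<close>
  define g where "g x = ennreal (Im (L x) / pi) * indicator {a..b} x" for x
  have cont: "continuous_on {a..b} (\<lambda>x. Im (L x) / pi)"
    using lim by (intro continuous_intros continuous_on_boundary_values) auto
  have "(\<lambda>x. ennreal (indicator {a..b} x *\<^sub>R (Im (L x) / pi))) \<in> borel_measurable borel"
    using cont by (intro measurable_compose[OF borel_measurable_continuous_on_indicator measurable_ennreal]) auto
  also have "(\<lambda>x. ennreal (indicator {a..b} x *\<^sub>R (Im (L x) / pi))) = g"
    by (auto simp: indicator_def g_def)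
  finally have [measurable]: "g \<in> borel_measurable borel" .
  have Icc: "emeasure M {y..b} = (\<integral>\<^sup>+x. g x * indicator {y..b} x \<partial>lborel)" if y: "a \<le> y" "y \<le> b" for y
  proof -
    have "emeasure M {y..b} = ennreal (1 / pi) * (ennreal pi * emeasure M {y..b})"
      by (simp add: mult.assoc[symmetric] ennreal_mult'[symmetric])
    also have "ennreal pi * emeasure M {y..b} = (\<integral>\<^sup>+x. ennreal (Im (L x)) * indicator {y..b} x \<partial>lborel)"
      using y lim by (intro emeasure_Icc_boundary) auto
    also have "\<dots> = (\<integral>\<^sup>+x. ennreal pi * (g x * indicator {y..b} x) \<partial>lborel)"
      using y by (intro nn_integral_cong) (auto simp: g_def indicator_def ennreal_mult'[symmetric])
    also have "\<dots> = ennreal pi * (\<integral>\<^sup>+x. g x * indicator {y..b} x \<partial>lborel)"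
      by (rule nn_integral_cmult) measurable
    also have "ennreal (1 / pi) * \<dots> = (\<integral>\<^sup>+x. g x * indicator {y..b} x \<partial>lborel)"
      by (simp add: mult.assoc[symmetric] ennreal_mult'[symmetric])
    finally show ?thesis .
  qed
  have dM: "emeasure (density M (indicator {a..b})) A = emeasure M ({a..b} \<inter> A)" if "A \<in> sets borel" for A
    using that by (subst emeasure_density) (auto simp: indicator_inter_arith[symmetric])
  have dL: "emeasure (density lborel g) A = (\<integral>\<^sup>+x. g x * indicator A x \<partial>lborel)" if "A \<in> sets borel" for A
    using that by (subst emeasure_density) auto
  have "density M (indicator {a..b}) = density lborel g"
  proof (rule measure_eqI_lessThan)
    fix y
    show "emeasure (density M (indicator {a..b})) {y<..} < \<infinity>"
      using compact_finite[OF compact_Icc, of a b] emeasure_mono[of "{a..b} \<inter> {y<..}" "{a..b}" M]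
      by (simp add: dM le_less_trans)
    show "emeasure (density M (indicator {a..b})) {y<..} = emeasure (density lborel g) {y<..}"
    proof -
      consider "y < a" | "a \<le> y" "y \<le> b" | "b < y" by linarith
      then show ?thesis
      proof cases
        case 1
        then have "{a..b} \<inter> {y<..} = {a..b}" by auto
        moreover have "g x * indicator {y<..} x = g x * indicator {a..b} x" for x
          using 1 by (auto simp: g_def indicator_def)
        ultimately show ?thesis using Icc[of a] True by (simp add: dM dL)
      next
        case 2
        \<comment> \<open>Closing the open end at y changes neither side: \<open>{y}\<close> is null
          for M and for Lebesgue measure.\<close>
        have "{y} \<in> null_sets M" using null_singleton[OF lim[of y]] 2 by (auto simp: null_sets_def)
        then have "emeasure M ({y} \<union> {y<..b}) = emeasure M {y<..b}" by (subst Un_commute) (rule emeasure_Un_null_set, auto)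
        moreover have "{y} \<union> {y<..b} = {y..b}" "{a..b} \<inter> {y<..} = {y<..b}" using 2 by auto
        ultimately have "emeasure M ({a..b} \<inter> {y<..}) = (\<integral>\<^sup>+x. g x * indicator {y..b} x \<partial>lborel)"
          using Icc[OF 2] by simp
        also have "\<dots> = (\<integral>\<^sup>+x. g x * indicator {y<..} x \<partial>lborel)"
        proof (rule nn_integral_cong_AE)
          show "AE x in lborel. g x * indicator {y..b} x = g x * indicator {y<..} x"
            using AE_lborel_singleton[of y] by eventually_elim (auto simp: g_def indicator_def)
        qed
        finally show ?thesis by (simp add: dM dL)
      next
        case 3
        then have "{a..b} \<inter> {y<..} = {}" by auto
        moreover have "g x * indicator {y<..} x = 0" for x
          using 3 by (auto simp: g_def indicator_def)
        ultimately show ?thesis by (simp add: dM dL del: mult_eq_0_iff)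
      qed
    qed
  qed simp_all
  then have "emeasure M ({a..b} \<inter> B) = (\<integral>\<^sup>+x. g x * indicator B x \<partial>lborel)"
    using dM[OF B(1)] dL[OF B(1)] by simp
  moreover have "{a..b} \<inter> B = B" using B by auto
  moreover have "g x * indicator B x = ennreal (Im (L x) / pi) * indicator B x" for x
    using B(2) by (auto simp: g_def indicator_def)
  ultimately show ?thesis by simp
next
  case False
  then have "B = {}" using B by auto
  then show ?thesis by simp
qed

text \<open>An open set is a countable union of compact intervals. Making this cover disjoint splits
  B into pieces that each lie in one interval, and countable additivity sums the instances of
  \<open>emeasure_subset_Icc_boundary\<close>.\<close>

theorem has_density_on_boundary:
  assumes U: "open U"
    and lim: "\<And>x. x \<in> U \<Longrightarrow> (f \<longlongrightarrow> L x) (at (complex_of_real x) within upper_half)"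
  shows "has_density_on M U (\<lambda>x. Im (L x) / pi)"
  unfolding has_density_on_def
proof (intro conjI ballI impI)
  show "0 \<le> Im (L x) / pi" if "x \<in> U" for x using Im_boundary_nonneg[OF lim[OF that]] by simp
  fix B :: "real set" assume B: "B \<in> sets borel" "B \<subseteq> U"
  define g where "g x = ennreal (Im (L x) / pi) * indicator U x" for x
  have cont: "continuous_on U (\<lambda>x. Im (L x) / pi)"
    using lim by (intro continuous_intros continuous_on_boundary_values) auto
  have "(\<lambda>x. ennreal (indicator U x *\<^sub>R (Im (L x) / pi))) \<in> borel_measurable borel"
    using cont U by (intro measurable_compose[OF borel_measurable_continuous_on_indicator measurable_ennreal]) auto
  also have "(\<lambda>x. ennreal (indicator U x *\<^sub>R (Im (L x) / pi))) = g"
    by (auto simp: indicator_def g_def)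
  finally have [measurable]: "g \<in> borel_measurable borel" .
  have dL: "emeasure (density lborel g) A = (\<integral>\<^sup>+x. ennreal (Im (L x) / pi) * indicator A x \<partial>lborel)"
    if "A \<in> sets borel" "A \<subseteq> U" for A
    using that by (subst emeasure_density) (auto intro!: nn_integral_cong simp: g_def indicator_def)
  show "emeasure M B = (\<integral>\<^sup>+x\<in>B. ennreal (Im (L x) / pi) \<partial>lborel)"
  proof (cases "U = {}")
    case False
    obtain \<D> where D: "countable \<D>" "\<D> \<subseteq> Pow U" "\<And>X. X \<in> \<D> \<Longrightarrow> \<exists>a b. X = cbox a b" "\<Union>\<D> = U"
      using open_countable_Union_open_cbox[OF U] by blast
    have "\<D> \<noteq> {}" using D(4) False by auto
    define A where "A = from_nat_into \<D>"
    have A: "range A = \<D>" unfolding A_def using \<open>\<D> \<noteq> {}\<close> D(1) by (rule range_from_nat_into)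
    have A_Icc: "\<exists>a b. A i = {a..b} \<and> {a..b} \<subseteq> U" for i
    proof -
      have i: "A i \<in> \<D>" using A by auto
      obtain a b where "A i = cbox a b" using D(3)[OF i] by blast
      then have "A i = {a..b}" by simp
      moreover have "A i \<subseteq> U" using D(2) i by blast
      ultimately show ?thesis by auto
    qed
    have A_sets: "range A \<subseteq> sets borel"
    proof (rule image_subsetI)
      show "A i \<in> sets borel" for i using A_Icc[of i] by auto
    qed
    let ?P = "\<lambda>i. B \<inter> disjointed A i"
    have P_sets: "?P i \<in> sets borel" for i
      using B(1) sets.range_disjointed_sets[OF A_sets] by auto
    then have P_range: "range ?P \<subseteq> sets borel" by (rule image_subsetI)
    have P_un: "(\<Union>i. ?P i) = B" using B(2) D(4) A UN_disjointed_eq[of A] by (simp add: Int_UN_distrib[symmetric] Int_absorb2)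
    have P_disj: "disjoint_family ?P"
      using disjoint_family_disjointed[of A] by (auto simp: disjoint_family_on_def)
    have eq: "emeasure M (?P i) = emeasure (density lborel g) (?P i)" for i
    proof -
      obtain a b where ab: "A i = {a..b}" "{a..b} \<subseteq> U" using A_Icc by blast
      have "?P i \<subseteq> {a..b}" using disjointed_subset[of A i] ab by auto
      then have "emeasure M (?P i) = (\<integral>\<^sup>+x. ennreal (Im (L x) / pi) * indicator (?P i) x \<partial>lborel)"
        using ab lim P_sets by (intro emeasure_subset_Icc_boundary) auto
      moreover have "?P i \<subseteq> U" using B(2) by auto
      ultimately show ?thesis using dL[OF P_sets[of i]] by simp
    qed
    have "emeasure M B = (\<Sum>i. emeasure M (?P i))"
      using suminf_emeasure[of ?P M] P_range P_disj P_un by simp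
    also have "\<dots> = (\<Sum>i. emeasure (density lborel g) (?P i))" by (simp add: eq)
    also have "\<dots> = emeasure (density lborel g) B"
      using suminf_emeasure[of ?P "density lborel g"] P_range P_disj P_un by simp
    finally show ?thesis using dL[OF B] by simp
  qed (use B in simp)
qed

end

text \<open>If g vanishes on U near x, a ball about x within U is null. Conversely, positivity of g
  at one point spreads by continuity to a ball, over which the density has a positive integral. This
  reduces equality of supports to comparing where the densities are positive.\<close>

lemma msupport_density_iff:
  assumes g: "has_density_on M U g" "continuous_on U g" and U: "open U" and x: "x \<in> U"
    and sets_M [simp]: "sets M = sets borel"
  shows "x \<in> msupport M \<longleftrightarrow> (\<forall>e>0. \<exists>y\<in>U \<inter> ball x e. g y > 0)"
proof
  assume supp: "x \<in> msupport M"
  show "\<forall>e>0. \<exists>y\<in>U \<inter> ball x e. g y > 0"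
  proof (rule ccontr, clarsimp)
    fix e :: real assume e: "e > 0" and no: "\<forall>y\<in>U \<inter> ball x e. \<not> 0 < g y"
    obtain d where d: "d > 0" "ball x d \<subseteq> U" using U x by (auto simp: open_contains_ball)
    let ?B = "ball x (min d e)"
    have "?B \<subseteq> U" using d by auto
    then have "emeasure M ?B = (\<integral>\<^sup>+y\<in>?B. ennreal (g y) \<partial>lborel)"
      using g(1) by (simp add: has_density_on_def)
    also have "\<dots> = (\<integral>\<^sup>+y. 0 \<partial>(lborel :: real measure))"
      using no \<open>?B \<subseteq> U\<close> by (intro nn_integral_cong) (auto simp: indicator_def ennreal_eq_0_iff not_less)
    finally have "emeasure M ?B = 0" by simp
    then show False using supp d(1) e by (auto simp: msupport_def)
  qed
next
  assume pos: "\<forall>e>0. \<exists>y\<in>U \<inter> ball x e. g y > 0"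
  show "x \<in> msupport M"
    unfolding msupport_def
  proof (intro CollectI allI impI notI)
    fix e :: real assume e: "e > 0" and null: "emeasure M (ball x e) = 0"
    obtain y where y: "y \<in> U" "y \<in> ball x e" "g y > 0" using pos e by blast
    have "open (U \<inter> ball x e)" using U by auto
    moreover have "continuous_on (U \<inter> ball x e) g" using g(2) by (rule continuous_on_subset) auto
    ultimately have "open ((U \<inter> ball x e) \<inter> g -` {0<..})" by (intro continuous_open_preimage) auto
    moreover have "y \<in> (U \<inter> ball x e) \<inter> g -` {0<..}" using y by auto
    ultimately obtain d where d: "d > 0" "ball y d \<subseteq> (U \<inter> ball x e) \<inter> g -` {0<..}"
      by (meson open_contains_ball)
    let ?B = "ball y d"
    have [measurable]: "(\<lambda>z. ennreal (g z) * indicator ?B z) \<in> borel_measurable borel"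
    proof -
      have "(\<lambda>z. ennreal (indicator ?B z *\<^sub>R g z)) \<in> borel_measurable borel"
        using g(2) d(2) by (intro measurable_compose[OF borel_measurable_continuous_on_indicator measurable_ennreal])
          (auto intro: continuous_on_subset)
      also have "(\<lambda>z. ennreal (indicator ?B z *\<^sub>R g z)) = (\<lambda>z. ennreal (g z) * indicator ?B z)"
        by (auto simp: indicator_def)
      finally show ?thesis .
    qed
    have "emeasure M ?B = (\<integral>\<^sup>+z. ennreal (g z) * indicator ?B z \<partial>lborel)"
      using g(1) d(2) by (auto simp: has_density_on_def)
    moreover have "emeasure M ?B = 0"
      using emeasure_mono[of ?B "ball x e" M] d(2) null by auto
    ultimately have "(\<integral>\<^sup>+z. ennreal (g z) * indicator ?B z \<partial>lborel) = 0" by simp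
    then have "AE z in lborel. ennreal (g z) * indicator ?B z = 0"
      by (subst (asm) nn_integral_0_iff_AE) auto
    then have "AE z in lborel. z \<notin> ?B" by eventually_elim (use d in \<open>auto simp: indicator_def ennreal_eq_0_iff split: if_splits\<close>)
    then have "emeasure lborel ?B = 0"
      by (subst (asm) AE_iff_measurable[of ?B]) auto
    then show False using d(1) emeasure_lborel_Ioo[of "y - d" "y + d"] by (simp add: ball_eq_greaterThanLessThan)
  qed
qed

section \<open>Resolvent integrals of one measure\<close>

text \<open>A bound in mean square gives uniform integrability through g \<le> min g R + g^2 / R.
  The truncated part tends to 0 by dominated convergence, constants being integrable for a finite
  measure, and the remainder is at most K / R.\<close>

lemma (in finite_measure) tendsto_integral_zero_of_bounded_square:
  fixes g :: "nat \<Rightarrow> 'a \<Rightarrow> real"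
  assumes meas [measurable]: "\<And>n. g n \<in> borel_measurable M"
    and nonneg: "\<And>n t. 0 \<le> g n t"
    and lim: "AE t in M. (\<lambda>n. g n t) \<longlonglongrightarrow> 0"
    and int: "\<And>n. integrable M (g n)" "\<And>n. integrable M (\<lambda>t. (g n t)\<^sup>2)"
    and bound: "\<And>n. (\<integral>t. (g n t)\<^sup>2 \<partial>M) \<le> K"
  shows "(\<lambda>n. \<integral>t. g n t \<partial>M) \<longlonglongrightarrow> 0"
proof (rule LIMSEQ_I)
  fix e :: real assume e: "e > 0"
  \<comment> \<open>Chosen so that \<open>K / R\<close> is at most \<open>e / 2\<close>; the summand
    1 keeps \<open>R\<close> positive even for K = 0.\<close>
  define R where "R = 2 * (\<bar>K\<bar> + 1) / e"
  have R: "R > 0" using e by (simp add: R_def)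
  have KR: "K / R < e / 2 + e / 4"
  proof -
    have "K / R \<le> (\<bar>K\<bar> + 1) / R" using R by (simp add: divide_right_mono)
    also have "\<dots> = e / 2" using e by (simp add: R_def field_simps)
    finally show ?thesis using e by linarith
  qed
  have "(\<lambda>n. \<integral>t. min (g n t) R \<partial>M) \<longlonglongrightarrow> (\<integral>t. 0 \<partial>M)"
  proof (rule integral_dominated_convergence[where w = "\<lambda>_. R"])
    show "AE t in M. (\<lambda>n. min (g n t) R) \<longlonglongrightarrow> 0"
      using lim
    proof eventually_elim
      case (elim t)
      then show ?case using tendsto_min[OF elim tendsto_const[of R]] R by simp
    qed
  qed (use nonneg R in auto)
  then have "(\<lambda>n. \<integral>t. min (g n t) R \<partial>M) \<longlonglongrightarrow> 0" by simp
  then obtain N where N: "\<And>n. n \<ge> N \<Longrightarrow> \<bar>\<integral>t. min (g n t) R \<partial>M\<bar> < e / 4"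
    using LIMSEQ_D[of _ 0 "e/4"] e by fastforce
  show "\<exists>no. \<forall>n\<ge>no. norm ((\<integral>t. g n t \<partial>M) - 0) < e"
  proof (intro exI allI impI)
    fix n assume n: "n \<ge> N"
    have int_min: "integrable M (\<lambda>t. min (g n t) R)"
      by (rule Bochner_Integration.integrable_bound[OF int(1)[of n]]) (use nonneg R in \<open>auto simp: min_def\<close>)
    have "(\<integral>t. g n t \<partial>M) \<le> (\<integral>t. min (g n t) R + (g n t)\<^sup>2 / R \<partial>M)"
    proof (rule integral_mono)
      show "integrable M (\<lambda>t. min (g n t) R + (g n t)\<^sup>2 / R)"
        using int_min int(2) by (intro Bochner_Integration.integrable_add) auto
      fix t
      show "g n t \<le> min (g n t) R + (g n t)\<^sup>2 / R"
      proof (cases "g n t \<le> R")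
        case True then show ?thesis using R by (simp add: min_def)
      next
        case False
        then have "g n t * R \<le> (g n t)\<^sup>2" using R by (simp add: power2_eq_square)
        then have "g n t \<le> (g n t)\<^sup>2 / R" using R by (simp add: field_simps)
        then show ?thesis using False R by (simp add: min_def)
      qed
    qed (use int in auto)
    also have "\<dots> = (\<integral>t. min (g n t) R \<partial>M) + (\<integral>t. (g n t)\<^sup>2 \<partial>M) / R"
      using int_min int(2) by (subst Bochner_Integration.integral_add) auto
    also have "\<dots> < e / 4 + (e / 2 + e / 4)"
      using N[OF n] KR divide_right_mono[OF bound[of n], of R] R by linarith
    finally show "norm ((\<integral>t. g n t \<partial>M) - 0) < e"
      using Bochner_Integration.integral_nonneg[of M "g n"] nonneg by simp
  qed
qed

text \<open>Comparing u with \<open>k * cnj v\<close> makes the bilinear product u v the cross term,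
  which is the product that \<open>mixed\<close> integrates.\<close>

lemma norm_diff_mult_cnj_power2:
  fixes u v k :: complex
  shows "(norm (u - k * cnj v))\<^sup>2 = (norm u)\<^sup>2 - 2 * Re (cnj k * (u * v)) + (norm k)\<^sup>2 * (norm v)\<^sup>2"
  unfolding cmod_power2 by (simp add: power2_eq_square algebra_simps)

section \<open>The function t / (1 + d t)\<close>

definition resolvent :: "complex \<Rightarrow> real \<Rightarrow> complex" where
  "resolvent d t = of_real t / (1 + d * of_real t)"

lemma resolvent_measurable [measurable]: "resolvent d \<in> borel_measurable borel"
  unfolding resolvent_def by measurable

lemma one_plus_mult_nonzero: "Im d > 0 \<Longrightarrow> 1 + d * complex_of_real t \<noteq> 0"
  by (cases "t = 0") (auto simp: complex_eq_iff)

lemma norm_resolvent_le: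
  assumes "Im d > 0"
  shows "norm (resolvent d t) \<le> 1 / Im d"
proof -
  have "\<bar>t\<bar> * Im d = \<bar>Im (1 + d * of_real t)\<bar>" using assms by (simp add: abs_mult)
  also have "\<dots> \<le> norm (1 + d * of_real t)" by (rule abs_Im_le_cmod)
  finally show ?thesis
    using assms one_plus_mult_nonzero[OF assms, of t]
    by (simp add: resolvent_def norm_divide field_simps)
qed

text \<open>The lower bound is the same for all d of norm at most R; after squaring and integrating
  it keeps the energies away from 0.\<close>

lemma norm_resolvent_ge:
  assumes "Im d > 0" "norm d \<le> R"
  shows "\<bar>t\<bar> / (1 + R * \<bar>t\<bar>) \<le> norm (resolvent d t)"
proof -
  have "norm (1 + d * of_real t) \<le> 1 + norm d * \<bar>t\<bar>"
    using norm_triangle_ineq[of 1 "d * of_real t"] by (simp add: norm_mult)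
  also have "\<dots> \<le> 1 + R * \<bar>t\<bar>" using assms by (simp add: mult_right_mono)
  finally show ?thesis
    using one_plus_mult_nonzero[OF assms(1), of t]
    by (auto simp: resolvent_def norm_divide intro!: divide_left_mono)
      (metis (no_types) add_pos_nonneg abs_ge_zero assms(2) mult_nonneg_nonneg norm_ge_zero order_trans zero_less_one zero_less_norm_iff mult_pos_pos)
qed

text \<open>The analogue of the resolvent identity, and the source of the product integrals
  \<open>mixed\<close>.\<close>

lemma resolvent_diff:
  assumes "Im d1 > 0" "Im d2 > 0"
  shows "resolvent d1 t - resolvent d2 t = (d2 - d1) * (resolvent d1 t * resolvent d2 t)"
  using one_plus_mult_nonzero[OF assms(1), of t] one_plus_mult_nonzero[OF assms(2), of t]
  by (simp add: resolvent_def field_simps)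

text \<open>Expanding by the conjugate of the denominator splits off a real term and a nonnegative
  multiple of \<open>cnj d\<close>, so the imaginary part sees only the squared norm.\<close>

lemma resolvent_eq:
  assumes "Im d > 0"
  shows "resolvent d t = of_real (t / (norm (1 + d * of_real t))\<^sup>2) + cnj d * of_real ((norm (resolvent d t))\<^sup>2)"
proof -
  let ?w = "1 + d * complex_of_real t"
  have w: "?w \<noteq> 0" using assms by (rule one_plus_mult_nonzero)
  have ww: "(complex_of_real (norm ?w))\<^sup>2 = ?w * cnj ?w" using complex_norm_square[of ?w] by simp
  have cw: "cnj ?w \<noteq> 0" using w by (subst complex_cnj_zero_iff)
  have "resolvent d t = of_real t * cnj ?w / (?w * cnj ?w)"
    unfolding resolvent_def using cw by (rule nonzero_mult_divide_mult_cancel_right[symmetric])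
  also have "\<dots> = of_real (t / (norm ?w)\<^sup>2) + cnj d * of_real (t\<^sup>2 / (norm ?w)\<^sup>2)"
    unfolding of_real_divide of_real_power ww by (simp add: add_divide_distrib algebra_simps power2_eq_square)
  also have "t\<^sup>2 / (norm ?w)\<^sup>2 = (norm (resolvent d t))\<^sup>2"
    by (simp add: resolvent_def norm_divide power_divide)
  finally show ?thesis .
qed

text \<open>\<open>charges_positive\<close> is the usable form of the assumption that a measure on
  the half-line differs from the Dirac mass at 0. The total mass is left open so that the constant c
  can be absorbed.\<close>

locale half_line_measure = finite_measure M for M :: "real measure" +
  assumes sets_M [measurable_cong, simp]: "sets M = sets borel"
    and AE_nonneg: "AE t in M. 0 \<le> t"
    and charges_positive: "emeasure M {0<..} \<noteq> 0"
begin

section \<open>Energies, moments and Cauchy-Schwarz\<close>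

definition energy :: "complex \<Rightarrow> real" where
  "energy d = (\<integral>t. (norm (resolvent d t))\<^sup>2 \<partial>M)"

text \<open>Bilinear rather than Hermitian, because the difference of the equations at two points
  produces this product.\<close>

definition mixed :: "complex \<Rightarrow> complex \<Rightarrow> complex" where
  "mixed d1 d2 = (\<integral>t. resolvent d1 t * resolvent d2 t \<partial>M)"

lemma integrable_bounded:
  fixes f :: "real \<Rightarrow> 'b::{banach, second_countable_topology}"
  assumes [measurable]: "f \<in> borel_measurable borel" and "\<And>t. norm (f t) \<le> B"
  shows "integrable M f"
  by (rule integrable_const_bound[of _ B]) (use assms in auto)

text \<open>The mass on the open half-line turns pointwise positivity there into positivity of the
  integral; the lower bounds for energy and moment rest on it.\<close>

lemma integral_pos:
  assumes f: "integrable M f" and nonneg: "\<And>t. 0 \<le> t \<Longrightarrow> 0 \<le> f t"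
    and pos: "\<And>t. 0 < t \<Longrightarrow> (0::real) < f t"
  shows "0 < (\<integral>t. f t \<partial>M)"
proof (rule ccontr)
  assume "\<not> 0 < (\<integral>t. f t \<partial>M)"
  moreover have AE: "AE t in M. 0 \<le> f t" using AE_nonneg by eventually_elim (rule nonneg)
  ultimately have "(\<integral>t. f t \<partial>M) = 0" using integral_nonneg_AE[OF AE] by simp
  then have "AE t in M. f t = 0" using integral_nonneg_eq_0_iff_AE[OF f AE] by simp
  then have "AE t in M. t \<notin> {0<..}" by eventually_elim (use pos in force)
  then have "emeasure M {0<..} = 0"
    by (subst (asm) AE_iff_measurable[of "{0<..}"]) (auto simp: space_borel sets_eq_imp_space_eq[OF sets_M])
  then show False using charges_positive by simp
qed

lemma integrable_resolvent: "Im d > 0 \<Longrightarrow> integrable M (resolvent d)"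
  by (rule integrable_bounded[of _ "1 / Im d"]) (auto intro: norm_resolvent_le)

lemma integrable_norm_resolvent_power2:
  assumes "Im d > 0" shows "integrable M (\<lambda>t. (norm (resolvent d t))\<^sup>2)"
  by (rule integrable_bounded[of _ "(1 / Im d)\<^sup>2"])
    (use norm_resolvent_le[OF assms] in \<open>auto intro!: power_mono simp del: power_one_over\<close>)

lemma integrable_resolvent_mult:
  assumes "Im d1 > 0" "Im d2 > 0"
  shows "integrable M (\<lambda>t. resolvent d1 t * resolvent d2 t)"
  by (rule integrable_bounded[of _ "(1 / Im d1) * (1 / Im d2)"])
    (use norm_resolvent_le[OF assms(1)] norm_resolvent_le[OF assms(2)] assms
      in \<open>auto intro!: mult_mono simp: norm_mult simp del: times_divide_eq_left times_divide_eq_right\<close>)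

lemma integrable_weight:
  assumes "R > 0"
  shows "integrable M (\<lambda>t. \<bar>t\<bar> / (1 + R * \<bar>t\<bar>))" "integrable M (\<lambda>t. (\<bar>t\<bar> / (1 + R * \<bar>t\<bar>))\<^sup>2)"
    "integrable M (\<lambda>t. \<bar>t\<bar> / (1 + R * \<bar>t\<bar>)\<^sup>2)"
proof -
  have pos: "0 < 1 + R * \<bar>t\<bar>" for t using assms by (simp add: add_pos_nonneg)
  have b: "\<bar>t\<bar> / (1 + R * \<bar>t\<bar>) \<le> 1 / R" for t
    using assms pos[of t] by (simp add: field_simps)
  show "integrable M (\<lambda>t. \<bar>t\<bar> / (1 + R * \<bar>t\<bar>))"
    by (rule integrable_bounded[of _ "1 / R"]) (use b pos in \<open>auto simp: abs_of_pos\<close>)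
  show "integrable M (\<lambda>t. (\<bar>t\<bar> / (1 + R * \<bar>t\<bar>))\<^sup>2)"
    by (rule integrable_bounded[of _ "(1 / R)\<^sup>2"])
      (use b pos in \<open>auto simp: abs_of_pos less_imp_le simp del: power_one_over power_divide intro!: power_mono\<close>)
  show "integrable M (\<lambda>t. \<bar>t\<bar> / (1 + R * \<bar>t\<bar>)\<^sup>2)"
  proof (rule integrable_bounded[of _ "1 / R"])
    fix t
    have "\<bar>t\<bar> / (1 + R * \<bar>t\<bar>)\<^sup>2 \<le> \<bar>t\<bar> / (1 + R * \<bar>t\<bar>)"
      using assms pos[of t] by (intro divide_left_mono) (auto intro!: self_le_power)
    then show "norm (\<bar>t\<bar> / (1 + R * \<bar>t\<bar>)\<^sup>2) \<le> 1 / R" using b[of t] by simp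
  qed measurable
qed

lemma energy_lower_bound:
  assumes "R > 0"
  obtains k where "k > 0" "\<And>d. Im d > 0 \<Longrightarrow> norm d \<le> R \<Longrightarrow> k \<le> energy d"
proof
  show "0 < (\<integral>t. (\<bar>t\<bar> / (1 + R * \<bar>t\<bar>))\<^sup>2 \<partial>M)"
    using assms by (intro integral_pos integrable_weight zero_less_power divide_pos_pos)
      (auto intro: add_pos_pos)
  show "(\<integral>t. (\<bar>t\<bar> / (1 + R * \<bar>t\<bar>))\<^sup>2 \<partial>M) \<le> energy d" if "Im d > 0" "norm d \<le> R" for d
    unfolding energy_def
    using assms that norm_resolvent_ge[OF that]
    by (intro integral_mono integrable_weight integrable_norm_resolvent_power2 power_mono) auto
qed

text \<open>By \<open>resolvent_eq\<close> the integrand is \<open>resolvent d\<close> minus its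
  energy term, and both are integrable.\<close>

lemma integrable_first_moment:
  assumes "Im d > 0"
  shows "integrable M (\<lambda>t. t / (norm (1 + d * of_real t))\<^sup>2)"
proof -
  have "integrable M (\<lambda>t. resolvent d t - cnj d * of_real ((norm (resolvent d t))\<^sup>2))"
    using assms integrable_resolvent integrable_norm_resolvent_power2
    by (intro Bochner_Integration.integrable_diff integrable_mult_right integrable_of_real) auto
  then have "integrable M (\<lambda>t. Re (resolvent d t - cnj d * of_real ((norm (resolvent d t))\<^sup>2)))"
    by (rule integrable_Re)
  moreover have "Re (resolvent d t - cnj d * of_real ((norm (resolvent d t))\<^sup>2)) = t / (norm (1 + d * of_real t))\<^sup>2" for t
    by (subst resolvent_eq[OF assms]) simp
  ultimately show ?thesis by simp
qed

text \<open>The integrated real term of \<open>resolvent_eq\<close>. It is nonnegative because M is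
  carried by the half-line, which gives the energy inequality its sign.\<close>

definition moment :: "complex \<Rightarrow> real" where
  "moment d = (\<integral>t. t / (norm (1 + d * of_real t))\<^sup>2 \<partial>M)"

lemma moment_nonneg: "0 \<le> moment d"
  unfolding moment_def by (rule integral_nonneg_AE) (use AE_nonneg in eventually_elim, simp)

lemma moment_lower_bound:
  assumes "R > 0"
  obtains k where "k > 0" "\<And>d. Im d > 0 \<Longrightarrow> norm d \<le> R \<Longrightarrow> k \<le> moment d"
proof
  show "0 < (\<integral>t. \<bar>t\<bar> / (1 + R * \<bar>t\<bar>)\<^sup>2 \<partial>M)"
    using assms by (intro integral_pos integrable_weight zero_less_power divide_pos_pos)
      (auto intro: add_pos_pos)
  show "(\<integral>t. \<bar>t\<bar> / (1 + R * \<bar>t\<bar>)\<^sup>2 \<partial>M) \<le> moment d" if d: "Im d > 0" "norm d \<le> R" for d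
    unfolding moment_def
  proof (rule integral_mono_AE)
    show "AE t in M. \<bar>t\<bar> / (1 + R * \<bar>t\<bar>)\<^sup>2 \<le> t / (norm (1 + d * of_real t))\<^sup>2"
      using AE_nonneg
    proof eventually_elim
      case (elim t)
      have "norm (1 + d * of_real t) \<le> 1 + norm d * t"
        using norm_triangle_ineq[of 1 "d * of_real t"] elim by (simp add: norm_mult)
      also have "\<dots> \<le> 1 + R * t" using d elim by (simp add: mult_right_mono)
      finally have "(norm (1 + d * of_real t))\<^sup>2 \<le> (1 + R * t)\<^sup>2" by (intro power_mono) auto
      then show ?case using elim one_plus_mult_nonzero[OF d(1), of t] assms
        by (auto intro!: divide_left_mono mult_pos_pos simp: add_pos_nonneg)
    qed
  qed (use assms d in \<open>auto intro: integrable_weight integrable_first_moment\<close>)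
qed

lemma integral_resolvent_eq:
  assumes "Im d > 0"
  shows "(\<integral>t. resolvent d t \<partial>M) = of_real (moment d) + cnj d * of_real (energy d)"
proof -
  have "(\<integral>t. resolvent d t \<partial>M) =
    (\<integral>t. of_real (t / (norm (1 + d * of_real t))\<^sup>2) + cnj d * of_real ((norm (resolvent d t))\<^sup>2) \<partial>M)"
    by (subst resolvent_eq[OF assms]) (rule refl)
  also have "\<dots> = of_real (moment d) + cnj d * of_real (energy d)"
    unfolding moment_def energy_def
    using integrable_first_moment[OF assms] integrable_norm_resolvent_power2[OF assms]
    by (subst Bochner_Integration.integral_add)
       (auto intro!: integrable_mult_right integrable_of_real simp del: of_real_divide of_real_power)
  finally show ?thesis .
qed

lemma integral_resolvent_diff:
  assumes "Im d1 > 0" "Im d2 > 0"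
  shows "(\<integral>t. resolvent d1 t \<partial>M) - (\<integral>t. resolvent d2 t \<partial>M) = (d2 - d1) * mixed d1 d2"
proof -
  have "(\<integral>t. resolvent d1 t \<partial>M) - (\<integral>t. resolvent d2 t \<partial>M) = (\<integral>t. resolvent d1 t - resolvent d2 t \<partial>M)"
    using assms by (simp add: integrable_resolvent)
  then show ?thesis by (simp add: resolvent_diff[OF assms] mixed_def)
qed

text \<open>The mean square distance from \<open>resolvent d1\<close> to
  \<open>k * cnj (resolvent d2)\<close>. Its nonnegativity yields Cauchy-Schwarz for
  \<open>mixed\<close>, its vanishing the equality case.\<close>

lemma integral_defect:
  assumes "Im d1 > 0" "Im d2 > 0"
  shows "integrable M (\<lambda>t. (norm (resolvent d1 t - k * cnj (resolvent d2 t)))\<^sup>2)"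
    "(\<integral>t. (norm (resolvent d1 t - k * cnj (resolvent d2 t)))\<^sup>2 \<partial>M)
      = energy d1 - 2 * Re (cnj k * mixed d1 d2) + (norm k)\<^sup>2 * energy d2"
proof -
  note i = integrable_norm_resolvent_power2[OF assms(1)] integrable_norm_resolvent_power2[OF assms(2)]
    integrable_resolvent_mult[OF assms]
  have j: "integrable M (\<lambda>t. Re (cnj k * (resolvent d1 t * resolvent d2 t)))"
    using i(3) by (intro integrable_Re integrable_mult_right)
  have e: "(\<integral>t. Re (cnj k * (resolvent d1 t * resolvent d2 t)) \<partial>M) = Re (cnj k * mixed d1 d2)"
    unfolding mixed_def using i(3) by (subst integral_Re) (auto intro!: integrable_mult_right)
  show "integrable M (\<lambda>t. (norm (resolvent d1 t - k * cnj (resolvent d2 t)))\<^sup>2)"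
    unfolding norm_diff_mult_cnj_power2 using i j
    by (intro Bochner_Integration.integrable_add Bochner_Integration.integrable_diff integrable_mult_right) auto
  show "(\<integral>t. (norm (resolvent d1 t - k * cnj (resolvent d2 t)))\<^sup>2 \<partial>M)
      = energy d1 - 2 * Re (cnj k * mixed d1 d2) + (norm k)\<^sup>2 * energy d2"
    unfolding norm_diff_mult_cnj_power2 energy_def e[symmetric]
    using i(1,2) j by (simp del: times_complex.sel)
qed

lemma energy_pos:
  assumes "Im d > 0" shows "energy d > 0"
proof -
  have "norm d > 0" using assms by auto
  then obtain k where "k > 0" "k \<le> energy d" using energy_lower_bound[of "norm d"] assms by (metis order_refl)
  then show ?thesis by simp
qed

lemma norm_mixed_power2_le:
  assumes "Im d1 > 0" "Im d2 > 0"
  shows "(norm (mixed d1 d2))\<^sup>2 \<le> energy d1 * energy d2"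
proof -
  \<comment> \<open>\<open>?k\<close> minimizes the quadratic expression in k of
    \<open>integral_defect\<close>.\<close>
  let ?S = "mixed d1 d2" and ?k = "mixed d1 d2 / of_real (energy d2)"
  have e: "energy d2 > 0" using assms(2) by (rule energy_pos)
  have "0 \<le> energy d1 - 2 * Re (cnj ?k * ?S) + (norm ?k)\<^sup>2 * energy d2"
    unfolding integral_defect(2)[OF assms, symmetric] by simp
  also have "Re (cnj ?k * ?S) = (norm ?S)\<^sup>2 / energy d2"
    by (simp add: cmod_power2 add_divide_distrib) (simp add: power2_eq_square)
  also have "(norm ?k)\<^sup>2 * energy d2 = (norm ?S)\<^sup>2 / energy d2"
    using e by (simp add: norm_divide power_divide power2_eq_square)
  finally show ?thesis using e by (simp add: field_simps)
qed

text \<open>Cauchy-Schwarz against the constant 1, from the nonnegative variance of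
  \<open>norm (f t)\<close> about its mean \<open>l\<close>.\<close>

lemma integral_norm_power2_le:
  fixes f :: "real \<Rightarrow> 'b::{banach, second_countable_topology}"
  assumes "integrable M f" "integrable M (\<lambda>t. (norm (f t))\<^sup>2)"
  shows "(\<integral>t. norm (f t) \<partial>M)\<^sup>2 \<le> measure M (space M) * (\<integral>t. (norm (f t))\<^sup>2 \<partial>M)"
proof -
  let ?n = "measure M (space M)" and ?I = "\<integral>t. norm (f t) \<partial>M" and ?J = "\<integral>t. (norm (f t))\<^sup>2 \<partial>M"
  have n: "?n > 0"
    using charges_positive finite_measure_mono[of "{0<..}" "space M"] measure_nonneg[of M "{0<..}"]
    by (auto simp: emeasure_eq_measure zero_less_measure_iff sets_eq_imp_space_eq[OF sets_M]
        simp del: measure_nonneg)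
  define l where "l = ?I / ?n"
  have "0 \<le> (\<integral>t. (norm (f t) - l)\<^sup>2 \<partial>M)" by simp
  also have "\<dots> = (\<integral>t. ((norm (f t))\<^sup>2 - 2 * l * norm (f t)) + l\<^sup>2 \<partial>M)"
    by (simp add: power2_eq_square algebra_simps)
  also have "\<dots> = ?J - 2 * l * ?I + l\<^sup>2 * ?n"
    using assms by (subst Bochner_Integration.integral_add Bochner_Integration.integral_diff; auto)+
  also have "\<dots> = ?J - ?I\<^sup>2 / ?n"
    using n by (simp add: l_def power2_eq_square)
  finally show ?thesis using n by (simp add: field_simps)
qed

lemma norm_integral_resolvent_power2_le:
  assumes "Im d > 0"
  shows "(norm (\<integral>t. resolvent d t \<partial>M))\<^sup>2 \<le> measure M (space M) * energy d"
proof -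
  have "(norm (\<integral>t. resolvent d t \<partial>M))\<^sup>2 \<le> (\<integral>t. norm (resolvent d t) \<partial>M)\<^sup>2"
    by (intro power_mono integral_norm_bound) auto
  also have "\<dots> \<le> measure M (space M) * energy d"
    unfolding energy_def
    using assms by (intro integral_norm_power2_le integrable_resolvent integrable_norm_resolvent_power2)
  finally show ?thesis .
qed

section \<open>Equality in Cauchy-Schwarz along sequences\<close>

lemma integrable_defect:
  assumes "Im d1 > 0" "Im d2 > 0"
  shows "integrable M (\<lambda>t. resolvent d1 t - k * cnj (resolvent d2 t))"
  using assms
  by (intro Bochner_Integration.integrable_diff integrable_mult_right integrable_cnj integrable_resolvent)

text \<open>For this k the mean square defect tends to
  \<open>\<alpha>1 - (norm S)\<^sup>2 / \<alpha>2 = 0\<close>, and on a finite measure the mean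
  square controls the mean.\<close>

lemma defect_tendsto_zero:
  assumes Im: "\<And>n. Im (e1 n) > 0" "\<And>n. Im (e2 n) > 0"
    and lim: "(\<lambda>n. energy (e1 n)) \<longlonglongrightarrow> \<alpha>1" "(\<lambda>n. energy (e2 n)) \<longlonglongrightarrow> \<alpha>2"
      "(\<lambda>n. mixed (e1 n) (e2 n)) \<longlonglongrightarrow> S"
    and S: "\<alpha>2 > 0" "(norm S)\<^sup>2 = \<alpha>1 * \<alpha>2" "k = S / of_real \<alpha>2"
  shows "(\<lambda>n. \<integral>t. norm (resolvent (e1 n) t - k * cnj (resolvent (e2 n) t)) \<partial>M) \<longlonglongrightarrow> 0"
proof -
  let ?f = "\<lambda>n t. resolvent (e1 n) t - k * cnj (resolvent (e2 n) t)"
  let ?J = "\<lambda>n. \<integral>t. (norm (?f n t))\<^sup>2 \<partial>M"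
  have "?J \<longlonglongrightarrow> \<alpha>1 - 2 * Re (cnj k * S) + (norm k)\<^sup>2 * \<alpha>2"
    unfolding integral_defect(2)[OF Im] by (intro tendsto_intros lim)
  also have "Re (cnj k * S) = (norm S)\<^sup>2 / \<alpha>2"
    unfolding S(3) by (simp add: cmod_power2 add_divide_distrib) (simp add: power2_eq_square)
  also have "(norm k)\<^sup>2 * \<alpha>2 = (norm S)\<^sup>2 / \<alpha>2"
    unfolding S(3) using S(1) by (simp add: norm_divide power_divide power2_eq_square)
  also have "\<alpha>1 - 2 * ((norm S)\<^sup>2 / \<alpha>2) + (norm S)\<^sup>2 / \<alpha>2 = 0"
    using S(1,2) by simp
  finally have J: "?J \<longlonglongrightarrow> 0" .
  have "(\<lambda>n. sqrt (measure M (space M) * ?J n)) \<longlonglongrightarrow> sqrt (measure M (space M) * 0)"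
    by (intro tendsto_intros J)
  then have lim0: "(\<lambda>n. sqrt (measure M (space M) * ?J n)) \<longlonglongrightarrow> 0" by simp
  have "(\<integral>t. norm (?f n t) \<partial>M) \<le> sqrt (measure M (space M) * ?J n)" for n
    using Im by (intro real_le_rsqrt integral_norm_power2_le integrable_defect integral_defect(1))
  then have "norm (\<integral>t. norm (?f n t) \<partial>M) \<le> sqrt (measure M (space M) * ?J n)" for n
    by (simp add: abs_of_nonneg)
  then show ?thesis by (rule Lim_null_comparison[OF always_eventually[OF allI] lim0])
qed

lemma defect_limit_eq:
  assumes Im: "\<And>n. Im (e1 n) > 0" "\<And>n. Im (e2 n) > 0"
    and defect: "(\<lambda>n. \<integral>t. norm (resolvent (e1 n) t - k * cnj (resolvent (e2 n) t)) \<partial>M) \<longlonglongrightarrow> 0"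
    and lim: "(\<lambda>n. \<integral>t. resolvent (e1 n) t \<partial>M) \<longlonglongrightarrow> l1" "(\<lambda>n. \<integral>t. resolvent (e2 n) t \<partial>M) \<longlonglongrightarrow> l2"
  shows "l1 = k * cnj l2"
proof -
  have eq: "(\<integral>t. resolvent (e1 n) t - k * cnj (resolvent (e2 n) t) \<partial>M)
      = (\<integral>t. resolvent (e1 n) t \<partial>M) - k * cnj (\<integral>t. resolvent (e2 n) t \<partial>M)" for n
    using Im by (simp add: integrable_resolvent)
  have "(\<lambda>n. \<integral>t. resolvent (e1 n) t - k * cnj (resolvent (e2 n) t) \<partial>M) \<longlonglongrightarrow> 0"
    by (rule Lim_null_comparison[OF always_eventually[OF allI[OF integral_norm_bound]] defect])
  moreover have "(\<lambda>n. \<integral>t. resolvent (e1 n) t - k * cnj (resolvent (e2 n) t) \<partial>M) \<longlonglongrightarrow> l1 - k * cnj l2"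
    unfolding eq by (intro tendsto_intros lim)
  ultimately have "l1 - k * cnj l2 = 0" by (rule LIMSEQ_unique[symmetric])
  then show ?thesis by simp
qed

text \<open>The shape of the resolvent pins down the constant of proportionality. The defect equals
  t (1 - k + h t) over the product of the two denominators, with \<open>h\<close> tending to 0, so a
  vanishing defect leaves no room for a nonzero \<open>1 - k\<close>.\<close>

lemma defect_phase_eq_1:
  assumes Im: "\<And>n. Im (e1 n) > 0" "\<And>n. Im (e2 n) > 0"
    and defect: "(\<lambda>n. \<integral>t. norm (resolvent (e1 n) t - k * cnj (resolvent (e2 n) t)) \<partial>M) \<longlonglongrightarrow> 0"
    and lim: "e1 \<longlonglongrightarrow> l1" "e2 \<longlonglongrightarrow> l2" and l: "k * l1 = cnj l2"
    and bound: "\<And>n. norm (e1 n) \<le> R" "\<And>n. norm (e2 n) \<le> R"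
  shows "k = 1"
proof -
  have "Im (e1 0) \<le> R" using bound(1)[of 0] abs_Im_le_cmod[of "e1 0"] by linarith
  then have R: "R > 0" using Im(1)[of 0] by linarith
  define h where "h n = cnj (e2 n) - k * e1 n" for n
  have "h \<longlonglongrightarrow> cnj l2 - k * l1" unfolding h_def by (intro tendsto_intros lim)
  then have h: "h \<longlonglongrightarrow> 0" using l by simp
  \<comment> \<open>Both denominators are at most 1 + R |t| in norm, which leads to weights that do
    not depend on n; \<open>?w1\<close> has a positive integral.\<close>
  let ?I = "\<lambda>n. \<integral>t. norm (resolvent (e1 n) t - k * cnj (resolvent (e2 n) t)) \<partial>M"
  let ?w1 = "\<lambda>t. \<bar>t\<bar> / (1 + R * \<bar>t\<bar>)\<^sup>2" and ?w2 = "\<lambda>t. (\<bar>t\<bar> / (1 + R * \<bar>t\<bar>))\<^sup>2"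
  have pw: "norm (1 - k) * ?w1 t \<le> norm (resolvent (e1 n) t - k * cnj (resolvent (e2 n) t)) + norm (h n) * ?w2 t" for n t
  proof -
    let ?u = "1 + e1 n * of_real t" and ?v = "1 + cnj (e2 n) * of_real t"
    have u: "?u \<noteq> 0" using Im(1) by (rule one_plus_mult_nonzero)
    have "cnj (1 + e2 n * of_real t) \<noteq> 0"
      using one_plus_mult_nonzero[OF Im(2), of n t] by (subst complex_cnj_zero_iff)
    then have v: "?v \<noteq> 0" by simp
    have le: "norm (1 + d * complex_of_real t) \<le> 1 + R * \<bar>t\<bar>" if "norm d \<le> R" for d
    proof -
      have "norm (1 + d * complex_of_real t) \<le> 1 + norm d * \<bar>t\<bar>"
        using norm_triangle_ineq[of 1 "d * of_real t"] by (simp add: norm_mult)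
      also have "\<dots> \<le> 1 + R * \<bar>t\<bar>" using that by (simp add: mult_right_mono)
      finally show ?thesis .
    qed
    have "resolvent (e1 n) t - k * cnj (resolvent (e2 n) t) = of_real t * (1 - k + h n * of_real t) / (?u * ?v)"
      using u v by (simp add: resolvent_def h_def field_simps)
    then have eq: "norm (resolvent (e1 n) t - k * cnj (resolvent (e2 n) t))
        = \<bar>t\<bar> * norm (1 - k + h n * of_real t) / (norm ?u * norm ?v)"
      by (simp add: norm_mult norm_divide)
    \<comment> \<open>The triangle inequality isolates \<open>1 - k\<close> in the numerator; the
      price, multiplied by |t| / (1 + R |t|)^2, is the term with \<open>?w2\<close>.\<close>
    have "norm (1 - k) \<le> norm (1 - k + h n * of_real t) + norm (h n) * \<bar>t\<bar>"
      using norm_triangle_ineq4[of "1 - k + h n * of_real t" "h n * of_real t"] by (simp add: norm_mult)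
    then have "\<bar>t\<bar> * norm (1 - k) \<le> \<bar>t\<bar> * (norm (1 - k + h n * of_real t) + norm (h n) * \<bar>t\<bar>)"
      by (intro mult_left_mono) auto
    then have "\<bar>t\<bar> * norm (1 - k) / (1 + R * \<bar>t\<bar>)\<^sup>2
        \<le> \<bar>t\<bar> * (norm (1 - k + h n * of_real t) + norm (h n) * \<bar>t\<bar>) / (1 + R * \<bar>t\<bar>)\<^sup>2"
      by (intro divide_right_mono) auto
    also have "\<dots> = \<bar>t\<bar> * norm (1 - k + h n * of_real t) / (1 + R * \<bar>t\<bar>)\<^sup>2 + norm (h n) * ?w2 t"
      by (simp add: power_divide add_divide_distrib distrib_left power2_eq_square)
    also have "\<bar>t\<bar> * norm (1 - k + h n * of_real t) / (1 + R * \<bar>t\<bar>)\<^sup>2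
        \<le> \<bar>t\<bar> * norm (1 - k + h n * of_real t) / (norm ?u * norm ?v)"
      unfolding power2_eq_square using u v R bound
      by (intro divide_left_mono mult_mono le mult_pos_pos mult_nonneg_nonneg) (auto simp: add_pos_nonneg)
    finally show ?thesis unfolding eq by (simp add: mult.commute)
  qed
  have "norm (1 - k) * (\<integral>t. ?w1 t \<partial>M) \<le> ?I n + norm (h n) * (\<integral>t. ?w2 t \<partial>M)" for n
  proof -
    have i: "integrable M (\<lambda>t. norm (resolvent (e1 n) t - k * cnj (resolvent (e2 n) t)))"
      using Im by (intro integrable_norm integrable_defect)
    have "(\<integral>t. norm (1 - k) * ?w1 t \<partial>M)
        \<le> (\<integral>t. norm (resolvent (e1 n) t - k * cnj (resolvent (e2 n) t)) + norm (h n) * ?w2 t \<partial>M)"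
      using R pw i by (intro integral_mono Bochner_Integration.integrable_add integrable_mult_right integrable_weight) auto
    also have "\<dots> = ?I n + norm (h n) * (\<integral>t. ?w2 t \<partial>M)"
      using i R integrable_weight(2)[OF R] by (subst Bochner_Integration.integral_add) auto
    finally show ?thesis by (subst (asm) integral_mult_right_zero)
  qed
  moreover have "(\<lambda>n. ?I n + norm (h n) * (\<integral>t. ?w2 t \<partial>M)) \<longlonglongrightarrow> 0 + norm (0::complex) * (\<integral>t. ?w2 t \<partial>M)"
    by (intro tendsto_intros defect h)
  ultimately have "norm (1 - k) * (\<integral>t. ?w1 t \<partial>M) \<le> 0"
    by (intro LIMSEQ_le_const) auto
  moreover have "(\<integral>t. ?w1 t \<partial>M) > 0"
    using R by (intro integral_pos integrable_weight zero_less_power divide_pos_pos) (auto intro: add_pos_pos)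
  ultimately show ?thesis by (simp add: mult_le_0_iff)
qed

end

section \<open>The coupled system\<close>

locale coupled_system = M: half_line_measure M + M': half_line_measure M'
  for M M' :: "real measure" +
  fixes D D' :: "complex \<Rightarrow> complex"
  assumes Im_D: "\<And>z. Im z > 0 \<Longrightarrow> Im (D z) > 0" and Im_D': "\<And>z. Im z > 0 \<Longrightarrow> Im (D' z) > 0"
    and D_eq: "\<And>z. Im z > 0 \<Longrightarrow> z * D z = - (\<integral>t. resolvent (D' z) t \<partial>M)"
    and D'_eq: "\<And>z. Im z > 0 \<Longrightarrow> z * D' z = - (\<integral>t. resolvent (D z) t \<partial>M')"
begin

text \<open>With c absorbed into M the system is symmetric, so each fact about \<open>D\<close>
  yields its counterpart for \<open>D'\<close>.\<close>

lemma swap: "coupled_system M' M D' D"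
  by unfold_locales (simp_all add: Im_D Im_D' D_eq D'_eq)

section \<open>Energy inequalities on the upper half-plane\<close>

lemma Im_mult_D: "Im z > 0 \<Longrightarrow> Im (z * D z) = M.energy (D' z) * Im (D' z)"
  by (subst D_eq) (simp_all add: M.integral_resolvent_eq Im_D')

lemma Im_mult_D': "Im z > 0 \<Longrightarrow> Im (z * D' z) = M'.energy (D z) * Im (D z)"
  by (subst D'_eq) (simp_all add: M'.integral_resolvent_eq Im_D)

text \<open>Multiplying \<open>z * D z\<close> by \<open>cnj z\<close> and taking imaginary parts,
  with \<open>Im_mult_D'\<close> for the energy term, expresses the gap between the two sides times
  \<open>Im (D z)\<close> as the moment times \<open>Im z\<close>, which is nonnegative.\<close>

lemma energy_mult_le:
  assumes z: "Im z > 0"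
  shows "M.energy (D' z) * M'.energy (D z) \<le> (norm z)\<^sup>2"
proof -
  let ?E = "M.energy (D' z)" and ?E' = "M'.energy (D z)"
  have "(norm z)\<^sup>2 * Im (D z) = Im (cnj z * (z * D z))"
    by (simp add: cmod_power2) (simp add: power2_eq_square algebra_simps)
  also have "z * D z = - (of_real (M.moment (D' z)) + cnj (D' z) * of_real ?E)"
    using z by (simp add: D_eq M.integral_resolvent_eq Im_D')
  also have "Im (cnj z * \<dots>) = M.moment (D' z) * Im z + ?E * Im (z * D' z)"
    by (simp add: algebra_simps)
  also have "Im (z * D' z) = ?E' * Im (D z)" using z by (rule Im_mult_D')
  finally have "((norm z)\<^sup>2 - ?E * ?E') * Im (D z) = M.moment (D' z) * Im z"
    by (simp add: algebra_simps)
  moreover have "M.moment (D' z) * Im z \<ge> 0" using z M.moment_nonneg by simp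
  ultimately have "((norm z)\<^sup>2 - ?E * ?E') * Im (D z) \<ge> 0" by simp
  then show ?thesis using Im_D[OF z] by (simp add: zero_le_mult_iff)
qed

text \<open>Cauchy-Schwarz bounds the square of \<open>norm (z * D z)\<close> by the mass of
  \<open>M\<close> times the energy at \<open>D' z\<close>, and \<open>energy_mult_le\<close> trades
  that energy for the one at \<open>D z\<close>. In effect \<open>D z * resolvent (D z) t\<close> is
  bounded in mean square under \<open>M'\<close>, uniformly in z.\<close>

lemma norm_D_energy_le:
  assumes z: "Im z > 0"
  shows "(norm (D z))\<^sup>2 * M'.energy (D z) \<le> measure M (space M)"
proof -
  let ?n = "measure M (space M)" and ?E = "M.energy (D' z)" and ?E' = "M'.energy (D z)"
  have E': "?E' > 0" using Im_D[OF z] by (rule M'.energy_pos)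
  have "(norm (z * D z))\<^sup>2 \<le> ?n * ?E"
    using M.norm_integral_resolvent_power2_le[OF Im_D'[OF z]] z by (simp add: D_eq)
  then have "(norm z)\<^sup>2 * ((norm (D z))\<^sup>2 * ?E') \<le> ?n * ?E * ?E'"
    using E' by (simp add: norm_mult power_mult_distrib mult.assoc[symmetric])
  also have "\<dots> \<le> ?n * (norm z)\<^sup>2"
    using mult_left_mono[OF energy_mult_le[OF z], of ?n] by (simp add: mult.assoc)
  finally have "(norm z)\<^sup>2 * ((norm (D z))\<^sup>2 * ?E') \<le> (norm z)\<^sup>2 * ?n" by (simp only: mult.commute)
  moreover have "(norm z)\<^sup>2 > 0" using z by auto
  ultimately show ?thesis by (rule mult_left_le_imp_le)
qed

text \<open>Cauchy-Schwarz for \<open>z * D' z\<close> brings in the energy at \<open>D z\<close>,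
  which \<open>norm_D_energy_le\<close> bounds after multiplication by the square of
  \<open>norm (D z)\<close>.\<close>

lemma norm_mult_D_D'_le:
  assumes z: "Im z > 0"
  shows "(norm z * norm (D z) * norm (D' z))\<^sup>2 \<le> measure M (space M) * measure M' (space M')"
proof -
  let ?n = "measure M (space M)" and ?n' = "measure M' (space M')" and ?E' = "M'.energy (D z)"
  have "(norm z * norm (D z) * norm (D' z))\<^sup>2 = (norm (D z))\<^sup>2 * (norm (z * D' z))\<^sup>2"
    by (simp add: norm_mult power_mult_distrib)
  also have "\<dots> \<le> (norm (D z))\<^sup>2 * (?n' * ?E')"
    using M'.norm_integral_resolvent_power2_le[OF Im_D[OF z]] z
    by (intro mult_left_mono) (auto simp: D'_eq)
  also have "\<dots> = ?n' * ((norm (D z))\<^sup>2 * ?E')" by simp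
  also have "\<dots> \<le> ?n' * ?n" using norm_D_energy_le[OF z] by (intro mult_left_mono) auto
  finally show ?thesis by (simp add: mult.commute)
qed

lemma D_bounded_away_from_0:
  assumes r: "r > 0"
  obtains R where "R > 0" "\<And>z. Im z > 0 \<Longrightarrow> r \<le> norm z \<Longrightarrow> norm (D z) \<le> R"
proof (rule ccontr)
  let ?n = "measure M (space M)" and ?n' = "measure M' (space M')"
  assume "\<not> thesis"
  have "\<exists>z. Im z > 0 \<and> r \<le> norm z \<and> real n + 1 < norm (D z)" for n
  proof (rule ccontr)
    assume no: "\<not> (\<exists>z. Im z > 0 \<and> r \<le> norm z \<and> real n + 1 < norm (D z))"
    have thesis by (rule that[of "real n + 1"]) (use no in \<open>auto simp: not_less\<close>)
    with \<open>\<not> thesis\<close> show False by simp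
  qed
  then have "\<forall>n. \<exists>z. Im z > 0 \<and> r \<le> norm z \<and> real n + 1 < norm (D z)" by simp
  then obtain z where "\<forall>n. Im (z n) > 0 \<and> r \<le> norm (z n) \<and> real n + 1 < norm (D (z n))"
    by (rule choice[THEN exE])
  then have z: "\<And>n. Im (z n) > 0" "\<And>n. r \<le> norm (z n)" "\<And>n. real n + 1 < norm (D (z n))"
    by auto
  define d where "d n = D (z n)" for n
  define d' where "d' n = D' (z n)" for n
  have Im_d: "Im (d n) > 0" "Im (d' n) > 0" for n
    by (simp_all add: d_def d'_def z Im_D Im_D')
  have d_inf: "filterlim (\<lambda>n. norm (d n)) at_top sequentially"
  proof (rule filterlim_at_top_mono[OF filterlim_real_sequentially])
    show "\<forall>\<^sub>F n in sequentially. real n \<le> norm (d n)"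
    proof (intro always_eventually allI)
      show "real n \<le> norm (d n)" for n using z(3)[of n] by (simp add: d_def)
    qed
  qed
  \<comment> \<open>The product z d d' is bounded by \<open>norm_mult_D_D'_le\<close>, while the
    norm of z is at least r and that of d exceeds n + 1.\<close>
  have d'_0: "d' \<longlonglongrightarrow> 0"
  proof (rule Lim_null_comparison)
    show "(\<lambda>n. sqrt (?n * ?n') / r * inverse (real (Suc n))) \<longlonglongrightarrow> 0"
      using tendsto_mult_right_zero[OF LIMSEQ_inverse_real_of_nat] .
    show "\<forall>\<^sub>F n in sequentially. norm (d' n) \<le> sqrt (?n * ?n') / r * inverse (real (Suc n))"
    proof (intro always_eventually allI)
      fix n
      have "r * (real n + 1) * norm (d' n) \<le> norm (z n) * norm (d n) * norm (d' n)"
        using z(2,3)[of n] r by (intro mult_right_mono mult_mono) (auto simp: d_def)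
      also have "\<dots> \<le> sqrt (?n * ?n')"
        using norm_mult_D_D'_le[OF z(1)[of n]] unfolding d_def d'_def by (rule real_le_rsqrt)
      finally show "norm (d' n) \<le> sqrt (?n * ?n') / r * inverse (real (Suc n))"
        using r by (simp add: divide_simps mult_ac add.commute)
    qed
  qed
  \<comment> \<open>Each equation of the system represents this product as an integral; the two
    representations turn out to have different limits.\<close>
  define W where "W n = z n * d n * d' n" for n
  have W1: "W n = - (\<integral>t. d' n * resolvent (d' n) t \<partial>M)" for n
  proof -
    have "W n = d' n * (z n * d n)" by (simp add: W_def)
    also have "z n * d n = - (\<integral>t. resolvent (d' n) t \<partial>M)"
      unfolding d_def d'_def by (rule D_eq[OF z(1)])
    finally show ?thesis by simp
  qed
  have W2: "W n = - (\<integral>t. d n * resolvent (d n) t \<partial>M')" for n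
  proof -
    have "W n = d n * (z n * d' n)" by (simp add: W_def)
    also have "z n * d' n = - (\<integral>t. resolvent (d n) t \<partial>M')"
      unfolding d_def d'_def by (rule D'_eq[OF z(1)])
    finally show ?thesis by simp
  qed

  \<comment> \<open>The integrand tends to 0 pointwise with \<open>d'\<close>, and its mean square
    is at most the mass of \<open>M'\<close> by the swapped form of
    \<open>norm_D_energy_le\<close>.\<close>
  have "(\<lambda>n. \<integral>t. norm (d' n * resolvent (d' n) t) \<partial>M) \<longlonglongrightarrow> 0"
  proof (rule M.tendsto_integral_zero_of_bounded_square)
    show "AE t in M. (\<lambda>n. norm (d' n * resolvent (d' n) t)) \<longlonglongrightarrow> 0"
    proof (intro AE_I2 tendsto_norm_zero)
      fix t
      have "(\<lambda>n. d' n * (of_real t / (1 + d' n * of_real t))) \<longlonglongrightarrow> 0 * (of_real t / (1 + 0 * of_real t))"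
        by (intro tendsto_intros d'_0) simp
      then show "(\<lambda>n. d' n * resolvent (d' n) t) \<longlonglongrightarrow> 0" by (simp add: resolvent_def)
    qed
    show "integrable M (\<lambda>t. norm (d' n * resolvent (d' n) t))" for n
      using Im_d by (intro integrable_norm integrable_mult_right M.integrable_resolvent)
    have eq: "(norm (d' n * resolvent (d' n) t))\<^sup>2 = (norm (d' n))\<^sup>2 * (norm (resolvent (d' n) t))\<^sup>2" for n t
      by (simp add: norm_mult power_mult_distrib)
    show "integrable M (\<lambda>t. (norm (d' n * resolvent (d' n) t))\<^sup>2)" for n
      unfolding eq using Im_d by (intro integrable_mult_right M.integrable_norm_resolvent_power2)
    show "(\<integral>t. (norm (d' n * resolvent (d' n) t))\<^sup>2 \<partial>M) \<le> ?n'" for n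
      unfolding eq using coupled_system.norm_D_energy_le[OF swap z(1)[of n]]
      by (simp add: M.energy_def d'_def)
  qed auto
  then have "(\<lambda>n. \<integral>t. d' n * resolvent (d' n) t \<partial>M) \<longlonglongrightarrow> 0"
    by (rule Lim_null_comparison[OF always_eventually[OF allI[OF integral_norm_bound]]])
  then have W0: "W \<longlonglongrightarrow> 0" using tendsto_minus[of _ 0] unfolding W1[abs_def] by simp

  \<comment> \<open>As the norm of d tends to infinity, d t / (1 + d t) tends to 1 for t > 0 and is
    0 at t = 0; \<open>?i\<close> is this limit.\<close>
  let ?i = "\<lambda>t::real. complex_of_real (indicator {0<..} t)"
  have int_i: "integrable M' ?i" by (rule M'.integrable_bounded[of _ 1]) (auto simp: indicator_def)
  have int_f: "integrable M' (\<lambda>t. d n * resolvent (d n) t)" for n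
    using Im_d by (intro integrable_mult_right M'.integrable_resolvent)
  have "(\<lambda>n. \<integral>t. norm (d n * resolvent (d n) t - ?i t) \<partial>M') \<longlonglongrightarrow> 0"
  proof (rule M'.tendsto_integral_zero_of_bounded_square)
    show "AE t in M'. (\<lambda>n. norm (d n * resolvent (d n) t - ?i t)) \<longlonglongrightarrow> 0"
      using M'.AE_nonneg
    proof eventually_elim
      case (elim t)
      show ?case
      proof (cases "t = 0")
        case False
        with elim have t: "t > 0" by simp
        have "d n * resolvent (d n) t - ?i t = - inverse (1 + d n * of_real t)" for n
          using one_plus_mult_nonzero[OF Im_d(1)[of n], of t] t by (simp add: resolvent_def field_simps)
        then have eq: "norm (d n * resolvent (d n) t - ?i t) = inverse (norm (1 + d n * of_real t))" for n
          by (simp add: norm_inverse)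
        have "filterlim (\<lambda>n. - 1 + norm (d n) * t) at_top sequentially"
          using t by (intro filterlim_tendsto_add_at_top[OF tendsto_const]
            filterlim_at_top_mult_tendsto_pos[OF tendsto_const] d_inf)
        moreover have "- 1 + norm (d n) * t \<le> norm (1 + d n * of_real t)" for n
          using norm_triangle_ineq2[of "d n * of_real t" "- 1"] t by (simp add: norm_mult add.commute)
        ultimately have "filterlim (\<lambda>n. norm (1 + d n * of_real t)) at_top sequentially"
          by (rule filterlim_at_top_mono[OF _ always_eventually[OF allI]])
        then show ?thesis unfolding eq by (rule tendsto_inverse_0_at_top)
      qed (simp add: resolvent_def)
    qed
    show "integrable M' (\<lambda>t. norm (d n * resolvent (d n) t - ?i t))" for n
      by (intro integrable_norm Bochner_Integration.integrable_diff int_f int_i)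
    have le: "(norm (d n * resolvent (d n) t - ?i t))\<^sup>2 \<le> 2 * (norm (d n))\<^sup>2 * (norm (resolvent (d n) t))\<^sup>2 + 2" for n t
    proof -
      have "norm (d n * resolvent (d n) t - ?i t) \<le> norm (d n * resolvent (d n) t) + 1"
        using norm_triangle_ineq4[of "d n * resolvent (d n) t" "?i t"] by (auto simp: indicator_def split: if_splits)
      then have "(norm (d n * resolvent (d n) t - ?i t))\<^sup>2 \<le> (norm (d n * resolvent (d n) t) + 1)\<^sup>2"
        by (intro power_mono) auto
      also have "\<dots> \<le> 2 * (norm (d n * resolvent (d n) t))\<^sup>2 + 2"
        using zero_le_power2[of "norm (d n * resolvent (d n) t) - 1"]
        by (simp add: power2_eq_square algebra_simps)
      finally show ?thesis by (simp add: norm_mult power_mult_distrib)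
    qed
    have i: "integrable M' (\<lambda>t. 2 * (norm (d n))\<^sup>2 * (norm (resolvent (d n) t))\<^sup>2 + 2)" for n
      using M'.integrable_norm_resolvent_power2[OF Im_d(1)[of n]] by auto
    show i2: "integrable M' (\<lambda>t. (norm (d n * resolvent (d n) t - ?i t))\<^sup>2)" for n
      by (rule Bochner_Integration.integrable_bound[OF i[of n]]) (use le in auto)
    show "(\<integral>t. (norm (d n * resolvent (d n) t - ?i t))\<^sup>2 \<partial>M') \<le> 2 * ?n + 2 * ?n'" for n
    proof -
      have "(\<integral>t. (norm (d n * resolvent (d n) t - ?i t))\<^sup>2 \<partial>M')
          \<le> (\<integral>t. 2 * (norm (d n))\<^sup>2 * (norm (resolvent (d n) t))\<^sup>2 + 2 \<partial>M')"
        by (rule integral_mono[OF i2 i le])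
      also have "\<dots> = 2 * ((norm (d n))\<^sup>2 * M'.energy (d n)) + 2 * ?n'"
        using M'.integrable_norm_resolvent_power2[OF Im_d(1)[of n]] by (simp add: M'.energy_def)
      also have "\<dots> \<le> 2 * ?n + 2 * ?n'" using norm_D_energy_le[OF z(1)[of n]] by (simp add: d_def)
      finally show ?thesis .
    qed
  qed auto
  then have "(\<lambda>n. \<integral>t. d n * resolvent (d n) t - ?i t \<partial>M') \<longlonglongrightarrow> 0"
    by (rule Lim_null_comparison[OF always_eventually[OF allI[OF integral_norm_bound]]])
  moreover have "(\<integral>t. d n * resolvent (d n) t - ?i t \<partial>M') = - W n - (\<integral>t. ?i t \<partial>M')" for n
    unfolding W2 using int_f int_i by simp
  ultimately have "(\<lambda>n. - W n - (\<integral>t. ?i t \<partial>M')) \<longlonglongrightarrow> 0" by simp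
  \<comment> \<open>Since \<open>W\<close> tends to 0, the integral of \<open>?i\<close> has to
    vanish, that is, \<open>M'\<close> has no mass on the open half-line.\<close>
  moreover have "(\<lambda>n. - W n - (\<integral>t. ?i t \<partial>M')) \<longlonglongrightarrow> - 0 - (\<integral>t. ?i t \<partial>M')"
    by (intro tendsto_intros W0)
  ultimately have "- 0 - (\<integral>t. ?i t \<partial>M') = 0" by (rule LIMSEQ_unique[symmetric])
  then have "measure M' {0<..} = 0" by (simp add: sets_eq_imp_space_eq[OF M'.sets_M])
  then show False using M'.charges_positive by (simp add: M'.emeasure_eq_measure)
qed

text \<open>Boundedness of \<open>D\<close> and \<open>D'\<close> away from 0 feeds the lower bounds
  for energies and moment; taking minima and maxima leaves one pair of constants for the whole
  region.\<close>

lemma energy_bounds: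
  assumes r: "r > 0"
  obtains k R where "k > 0" "R > 0"
    "\<And>z. Im z > 0 \<Longrightarrow> r \<le> norm z \<Longrightarrow> norm (D z) \<le> R"
    "\<And>z. Im z > 0 \<Longrightarrow> r \<le> norm z \<Longrightarrow> norm (D' z) \<le> R"
    "\<And>z. Im z > 0 \<Longrightarrow> r \<le> norm z \<Longrightarrow> k \<le> M.energy (D' z)"
    "\<And>z. Im z > 0 \<Longrightarrow> r \<le> norm z \<Longrightarrow> k \<le> M'.energy (D z)"
    "\<And>z. Im z > 0 \<Longrightarrow> r \<le> norm z \<Longrightarrow> k \<le> M.moment (D' z)"
proof -
  obtain R1 where R1: "R1 > 0" "\<And>z. Im z > 0 \<Longrightarrow> r \<le> norm z \<Longrightarrow> norm (D z) \<le> R1"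
    using D_bounded_away_from_0[OF r] by metis
  obtain R2 where R2: "R2 > 0" "\<And>z. Im z > 0 \<Longrightarrow> r \<le> norm z \<Longrightarrow> norm (D' z) \<le> R2"
    using coupled_system.D_bounded_away_from_0[OF swap r] by metis
  obtain k1 where k1: "k1 > 0" "\<And>d. Im d > 0 \<Longrightarrow> norm d \<le> R2 \<Longrightarrow> k1 \<le> M.energy d"
    using M.energy_lower_bound[OF R2(1)] by metis
  obtain k2 where k2: "k2 > 0" "\<And>d. Im d > 0 \<Longrightarrow> norm d \<le> R1 \<Longrightarrow> k2 \<le> M'.energy d"
    using M'.energy_lower_bound[OF R1(1)] by metis
  obtain k3 where k3: "k3 > 0" "\<And>d. Im d > 0 \<Longrightarrow> norm d \<le> R2 \<Longrightarrow> k3 \<le> M.moment d"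
    using M.moment_lower_bound[OF R2(1)] by metis
  show ?thesis
  proof (rule that)
    show "min k1 (min k2 k3) > 0" "max R1 R2 > 0" using k1 k2 k3 R1 by auto
    fix z assume z: "Im z > 0" "r \<le> norm z"
    show "norm (D z) \<le> max R1 R2" "norm (D' z) \<le> max R1 R2"
      using R1(2)[OF z] R2(2)[OF z] by auto
    show "min k1 (min k2 k3) \<le> M.energy (D' z)"
      using k1(2)[OF Im_D'[OF z(1)] R2(2)[OF z]] by simp
    show "min k1 (min k2 k3) \<le> M'.energy (D z)"
      using k2(2)[OF Im_D[OF z(1)] R1(2)[OF z]] by simp
    show "min k1 (min k2 k3) \<le> M.moment (D' z)"
      using k3(2)[OF Im_D'[OF z(1)] R2(2)[OF z]] by simp
  qed
qed

section \<open>Cluster values at a nonzero real point\<close>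

lemma mult_D_diff:
  assumes "Im z1 > 0" "Im z2 > 0"
  shows "z1 * D z1 - z2 * D z2 = (D' z1 - D' z2) * M.mixed (D' z1) (D' z2)"
proof -
  have "z1 * D z1 - z2 * D z2 = - ((\<integral>t. resolvent (D' z1) t \<partial>M) - (\<integral>t. resolvent (D' z2) t \<partial>M))"
    by (simp add: D_eq assms)
  also have "\<dots> = - ((D' z2 - D' z1) * M.mixed (D' z1) (D' z2))"
    by (subst M.integral_resolvent_diff) (simp_all add: Im_D' assms)
  finally show ?thesis by (simp add: algebra_simps)
qed

text \<open>Division of \<open>mult_D_diff\<close> by the difference of the values of
  \<open>D'\<close>, which is eventually nonzero because its limit is.\<close>

lemma mixed_limit:
  assumes Im: "\<And>n. Im (z1 n) > 0" "\<And>n. Im (z2 n) > 0"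
    and z: "z1 \<longlonglongrightarrow> complex_of_real x" "z2 \<longlonglongrightarrow> complex_of_real x"
    and d: "(\<lambda>n. D (z1 n)) \<longlonglongrightarrow> d1" "(\<lambda>n. D (z2 n)) \<longlonglongrightarrow> d2"
    and d': "(\<lambda>n. D' (z1 n)) \<longlonglongrightarrow> d1'" "(\<lambda>n. D' (z2 n)) \<longlonglongrightarrow> d2'" and ne: "d1' \<noteq> d2'"
  shows "(\<lambda>n. M.mixed (D' (z1 n)) (D' (z2 n))) \<longlonglongrightarrow> of_real x * (d1 - d2) / (d1' - d2')"
proof -
  have diff: "(\<lambda>n. D' (z1 n) - D' (z2 n)) \<longlonglongrightarrow> d1' - d2'" by (intro tendsto_intros d')
  have "(\<lambda>n. (z1 n * D (z1 n) - z2 n * D (z2 n)) / (D' (z1 n) - D' (z2 n)))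
      \<longlonglongrightarrow> (of_real x * d1 - of_real x * d2) / (d1' - d2')"
    using ne by (intro tendsto_intros z d d') simp
  moreover have "\<forall>\<^sub>F n in sequentially. D' (z1 n) - D' (z2 n) \<noteq> 0"
    using ne by (intro tendsto_imp_eventually_ne[OF diff]) simp
  then have "\<forall>\<^sub>F n in sequentially. (z1 n * D (z1 n) - z2 n * D (z2 n)) / (D' (z1 n) - D' (z2 n))
      = M.mixed (D' (z1 n)) (D' (z2 n))"
    by eventually_elim (simp add: mult_D_diff Im)
  ultimately have "(\<lambda>n. M.mixed (D' (z1 n)) (D' (z2 n))) \<longlonglongrightarrow> (of_real x * d1 - of_real x * d2) / (d1' - d2')"
    by (rule Lim_transform_eventually)
  then show ?thesis by (simp add: right_diff_distrib)
qed

text \<open>Cauchy-Schwarz in \<open>mult_D_diff\<close> bounds the difference of the products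
  \<open>z * D z\<close> by that of the values of \<open>D'\<close>, with convergent energies as
  factors. Contrapositively, distinct limits of \<open>D\<close> force distinct limits of
  \<open>D'\<close>, so that both quotients in \<open>cluster_value_unique\<close> make
  sense.\<close>

lemma cluster_eq_cross:
  assumes Im: "\<And>n. Im (z1 n) > 0" "\<And>n. Im (z2 n) > 0"
    and z: "z1 \<longlonglongrightarrow> complex_of_real x" "z2 \<longlonglongrightarrow> complex_of_real x" and x: "x \<noteq> 0"
    and d: "(\<lambda>n. D (z1 n)) \<longlonglongrightarrow> d1" "(\<lambda>n. D (z2 n)) \<longlonglongrightarrow> d2"
    and d': "(\<lambda>n. D' (z1 n)) \<longlonglongrightarrow> d1'" "(\<lambda>n. D' (z2 n)) \<longlonglongrightarrow> d2'"
    and a: "(\<lambda>n. M.energy (D' (z1 n))) \<longlonglongrightarrow> \<alpha>1" "(\<lambda>n. M.energy (D' (z2 n))) \<longlonglongrightarrow> \<alpha>2"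
    and eq: "d1' = d2'"
  shows "d1 = d2"
proof -
  have "(norm (z1 n * D (z1 n) - z2 n * D (z2 n)))\<^sup>2
      \<le> (norm (D' (z1 n) - D' (z2 n)))\<^sup>2 * (M.energy (D' (z1 n)) * M.energy (D' (z2 n)))" for n
    unfolding mult_D_diff[OF Im] norm_mult power_mult_distrib
    using Im by (intro mult_left_mono M.norm_mixed_power2_le Im_D') auto
  moreover have "(\<lambda>n. (norm (z1 n * D (z1 n) - z2 n * D (z2 n)))\<^sup>2) \<longlonglongrightarrow> (norm (of_real x * d1 - of_real x * d2))\<^sup>2"
    by (intro tendsto_intros z d)
  moreover have "(\<lambda>n. (norm (D' (z1 n) - D' (z2 n)))\<^sup>2 * (M.energy (D' (z1 n)) * M.energy (D' (z2 n))))
      \<longlonglongrightarrow> (norm (d1' - d2'))\<^sup>2 * (\<alpha>1 * \<alpha>2)"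
    by (intro tendsto_intros d' a)
  ultimately have "(norm (of_real x * d1 - of_real x * d2))\<^sup>2 \<le> (norm (d1' - d2'))\<^sup>2 * (\<alpha>1 * \<alpha>2)"
    by (intro LIMSEQ_le) auto
  then show ?thesis using eq x by simp
qed

text \<open>Convergence of the energies is among the hypotheses so that Cauchy-Schwarz and the
  energy inequality can be compared in the limit; \<open>convergent_subsequence\<close> provides
  it.\<close>

lemma cluster_value_unique:
  assumes Im: "\<And>n. Im (z1 n) > 0" "\<And>n. Im (z2 n) > 0"
    and z: "z1 \<longlonglongrightarrow> complex_of_real x" "z2 \<longlonglongrightarrow> complex_of_real x" and x: "x \<noteq> 0"
    and r: "r > 0" "\<And>n. r \<le> norm (z1 n)" "\<And>n. r \<le> norm (z2 n)"
    and d: "(\<lambda>n. D (z1 n)) \<longlonglongrightarrow> d1" "(\<lambda>n. D (z2 n)) \<longlonglongrightarrow> d2"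
    and d': "(\<lambda>n. D' (z1 n)) \<longlonglongrightarrow> d1'" "(\<lambda>n. D' (z2 n)) \<longlonglongrightarrow> d2'"
    and a: "(\<lambda>n. M.energy (D' (z1 n))) \<longlonglongrightarrow> \<alpha>1" "(\<lambda>n. M.energy (D' (z2 n))) \<longlonglongrightarrow> \<alpha>2"
    and a': "(\<lambda>n. M'.energy (D (z1 n))) \<longlonglongrightarrow> \<alpha>1'" "(\<lambda>n. M'.energy (D (z2 n))) \<longlonglongrightarrow> \<alpha>2'"
  shows "d1 = d2"
proof (rule ccontr)
  assume ne: "d1 \<noteq> d2"
  then have ne': "d1' \<noteq> d2'" using cluster_eq_cross[OF Im z x d d' a] by blast
  interpret sw: coupled_system M' M D' D by (rule swap)
  define S where "S = of_real x * (d1 - d2) / (d1' - d2')"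
  define S' where "S' = of_real x * (d1' - d2') / (d1 - d2)"
  have S: "(\<lambda>n. M.mixed (D' (z1 n)) (D' (z2 n))) \<longlonglongrightarrow> S"
    unfolding S_def by (rule mixed_limit[OF Im z d d' ne'])
  have S': "(\<lambda>n. M'.mixed (D (z1 n)) (D (z2 n))) \<longlonglongrightarrow> S'"
    unfolding S'_def by (rule sw.mixed_limit[OF Im z d' d ne])
  \<comment> \<open>The two difference quotients are reciprocal up to the factors x.\<close>
  have SS': "S * S' = of_real (x\<^sup>2)"
    using ne ne' by (simp add: S_def S'_def power2_eq_square)
  obtain k R where k: "k > 0" and R: "R > 0"
    "\<And>z. Im z > 0 \<Longrightarrow> r \<le> norm z \<Longrightarrow> norm (D z) \<le> R"
    "\<And>z. Im z > 0 \<Longrightarrow> r \<le> norm z \<Longrightarrow> norm (D' z) \<le> R"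
    and E: "\<And>z. Im z > 0 \<Longrightarrow> r \<le> norm z \<Longrightarrow> k \<le> M.energy (D' z)"
    "\<And>z. Im z > 0 \<Longrightarrow> r \<le> norm z \<Longrightarrow> k \<le> M'.energy (D z)"
    "\<And>z. Im z > 0 \<Longrightarrow> r \<le> norm z \<Longrightarrow> k \<le> M.moment (D' z)"
    by (rule energy_bounds[OF r(1)]) blast
  have "k \<le> \<alpha>1" "k \<le> \<alpha>2" "k \<le> \<alpha>1'" "k \<le> \<alpha>2'"
    by (rule LIMSEQ_le_const[OF a(1)] LIMSEQ_le_const[OF a(2)] LIMSEQ_le_const[OF a'(1)] LIMSEQ_le_const[OF a'(2)];
        use E Im r in blast)+
  with k have pos: "\<alpha>1 > 0" "\<alpha>2 > 0" "\<alpha>1' > 0" "\<alpha>2' > 0" by linarith+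
  have prod: "\<alpha> * \<alpha>' \<le> x\<^sup>2"
    if "(\<lambda>n. M.energy (D' (w n))) \<longlonglongrightarrow> \<alpha>" "(\<lambda>n. M'.energy (D (w n))) \<longlonglongrightarrow> \<alpha>'"
      "\<And>n. Im (w n) > 0" "w \<longlonglongrightarrow> of_real x" for w \<alpha> \<alpha>'
  proof -
    have "(\<lambda>n. M.energy (D' (w n)) * M'.energy (D (w n))) \<longlonglongrightarrow> \<alpha> * \<alpha>'" by (intro tendsto_intros that)
    moreover have "(\<lambda>n. (norm (w n))\<^sup>2) \<longlonglongrightarrow> (norm (complex_of_real x))\<^sup>2" by (intro tendsto_intros that)
    ultimately have "\<alpha> * \<alpha>' \<le> (norm (complex_of_real x))\<^sup>2"
      using energy_mult_le[OF that(3)] by (intro LIMSEQ_le) auto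
    then show ?thesis by simp
  qed
  note p1 = prod[OF a(1) a'(1) Im(1) z(1)] and p2 = prod[OF a(2) a'(2) Im(2) z(2)]
  have q: "(norm S)\<^sup>2 \<le> \<alpha>1 * \<alpha>2"
  proof (rule LIMSEQ_le)
    show "(\<lambda>n. (norm (M.mixed (D' (z1 n)) (D' (z2 n))))\<^sup>2) \<longlonglongrightarrow> (norm S)\<^sup>2" by (intro tendsto_intros S)
    show "(\<lambda>n. M.energy (D' (z1 n)) * M.energy (D' (z2 n))) \<longlonglongrightarrow> \<alpha>1 * \<alpha>2" by (intro tendsto_intros a)
  qed (use M.norm_mixed_power2_le Im Im_D' in blast)
  have q': "(norm S')\<^sup>2 \<le> \<alpha>1' * \<alpha>2'"
  proof (rule LIMSEQ_le)
    show "(\<lambda>n. (norm (M'.mixed (D (z1 n)) (D (z2 n))))\<^sup>2) \<longlonglongrightarrow> (norm S')\<^sup>2" by (intro tendsto_intros S')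
    show "(\<lambda>n. M'.energy (D (z1 n)) * M'.energy (D (z2 n))) \<longlonglongrightarrow> \<alpha>1' * \<alpha>2'" by (intro tendsto_intros a')
  qed (use M'.norm_mixed_power2_le Im Im_D in blast)
  have x2: "x\<^sup>2 > 0" using x by simp
  have "norm S * norm S' = x\<^sup>2" by (subst norm_mult[symmetric]) (simp add: SS' norm_power)
  then have qq: "(norm S)\<^sup>2 * (norm S')\<^sup>2 = x\<^sup>2 * x\<^sup>2"
    by (metis power_mult_distrib power2_eq_square)
  have "S \<noteq> 0" "S' \<noteq> 0" using ne ne' x by (simp_all add: S_def S'_def)
  then have Spos: "(norm S)\<^sup>2 > 0" "(norm S')\<^sup>2 > 0" by simp_all
  \<comment> \<open>The chain x^4 \<le>
    \<open>(\<alpha>1 * \<alpha>2) * (\<alpha>1' * \<alpha>2')\<close> \<le>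
    \<open>x\<^sup>2 * (\<alpha>2 * \<alpha>2')\<close> \<le> x^4 closes up, so equality holds
    throughout.\<close>
  have low: "x\<^sup>2 * x\<^sup>2 \<le> (\<alpha>1 * \<alpha>2) * (\<alpha>1' * \<alpha>2')"
    unfolding qq[symmetric] using pos by (intro mult_mono q q') auto
  have up: "(\<alpha>1 * \<alpha>2) * (\<alpha>1' * \<alpha>2') \<le> x\<^sup>2 * (\<alpha>2 * \<alpha>2')"
    using mult_right_mono[OF p1, of "\<alpha>2 * \<alpha>2'"] pos by (simp add: mult_ac)
  have e2: "\<alpha>2 * \<alpha>2' = x\<^sup>2"
    using low up p2 x2 by (smt (verit) mult_left_mono mult_le_cancel_left_pos)
  have top: "(\<alpha>1 * \<alpha>2) * (\<alpha>1' * \<alpha>2') \<le> (norm S)\<^sup>2 * (norm S')\<^sup>2"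
    using up unfolding qq e2 .
  \<comment> \<open>Both Cauchy-Schwarz inequalities have positive sides and their product is an
    equality, so each of them is one.\<close>
  have eqS: "(norm S)\<^sup>2 = \<alpha>1 * \<alpha>2"
  proof (rule antisym[OF q])
    have "(\<alpha>1 * \<alpha>2) * (norm S')\<^sup>2 \<le> (\<alpha>1 * \<alpha>2) * (\<alpha>1' * \<alpha>2')" using q' pos by (intro mult_left_mono) auto
    also note top
    finally show "\<alpha>1 * \<alpha>2 \<le> (norm S)\<^sup>2" using Spos by simp
  qed
  have eqS': "(norm S')\<^sup>2 = \<alpha>1' * \<alpha>2'"
  proof (rule antisym[OF q'])
    have "(norm S)\<^sup>2 * (\<alpha>1' * \<alpha>2') \<le> (\<alpha>1 * \<alpha>2) * (\<alpha>1' * \<alpha>2')" using q pos by (intro mult_right_mono) auto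
    also note top
    finally show "\<alpha>1' * \<alpha>2' \<le> (norm S')\<^sup>2" using Spos by simp
  qed
  \<comment> \<open>\<open>c\<close> and \<open>c'\<close> are the constants of proportionality in
    the two equality cases; \<open>SS'\<close> and \<open>e2\<close> make them mutually
    inverse.\<close>
  define c where "c = S / of_real \<alpha>2"
  define c' where "c' = S' / of_real \<alpha>2'"
  have "c * c' = of_real (x\<^sup>2) / of_real (\<alpha>2 * \<alpha>2')" unfolding SS'[symmetric] by (simp add: c_def c'_def)
  then have cc': "c * c' = 1" unfolding e2 using x by simp
  note Im' = Im_D[OF Im(1)] Im_D[OF Im(2)] Im_D'[OF Im(1)] Im_D'[OF Im(2)]
  have def: "(\<lambda>n. \<integral>t. norm (resolvent (D' (z1 n)) t - c * cnj (resolvent (D' (z2 n)) t)) \<partial>M) \<longlonglongrightarrow> 0"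
    by (rule M.defect_tendsto_zero[OF Im'(3,4) a S pos(2) eqS c_def])
  have def': "(\<lambda>n. \<integral>t. norm (resolvent (D (z1 n)) t - c' * cnj (resolvent (D (z2 n)) t)) \<partial>M') \<longlonglongrightarrow> 0"
    by (rule M'.defect_tendsto_zero[OF Im'(1,2) a' S' pos(4) eqS' c'_def])
  have lim: "(\<lambda>n. \<integral>t. resolvent (D' (w n)) t \<partial>M) \<longlonglongrightarrow> - (of_real x * l)"
    if "\<And>n. Im (w n) > 0" "w \<longlonglongrightarrow> of_real x" "(\<lambda>n. D (w n)) \<longlonglongrightarrow> l" for w l
  proof -
    have "(\<lambda>n. - (w n * D (w n))) \<longlonglongrightarrow> - (of_real x * l)" by (intro tendsto_intros that)
    then show ?thesis by (simp add: D_eq that)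
  qed
  have lim': "(\<lambda>n. \<integral>t. resolvent (D (w n)) t \<partial>M') \<longlonglongrightarrow> - (of_real x * l)"
    if "\<And>n. Im (w n) > 0" "w \<longlonglongrightarrow> of_real x" "(\<lambda>n. D' (w n)) \<longlonglongrightarrow> l" for w l
  proof -
    have "(\<lambda>n. - (w n * D' (w n))) \<longlonglongrightarrow> - (of_real x * l)" by (intro tendsto_intros that)
    then show ?thesis by (simp add: D'_eq that)
  qed
  have "- (of_real x * d1) = c * cnj (- (of_real x * d2))"
    by (rule M.defect_limit_eq[OF Im'(3,4) def lim[OF Im(1) z(1) d(1)] lim[OF Im(2) z(2) d(2)]])
  then have "of_real x * d1 = of_real x * (c * cnj d2)" by (simp add: mult_ac)
  then have d1: "d1 = c * cnj d2" using x by simp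
  have "- (of_real x * d1') = c' * cnj (- (of_real x * d2'))"
    by (rule M'.defect_limit_eq[OF Im'(1,2) def' lim'[OF Im(1) z(1) d'(1)] lim'[OF Im(2) z(2) d'(2)]])
  then have "of_real x * d1' = of_real x * (c' * cnj d2')" by (simp add: mult_ac)
  then have "d1' = c' * cnj d2'" using x by simp
  \<comment> \<open>The relation between the limits on the side of \<open>M'\<close>, solved for the
    constant c that belongs to \<open>M\<close>: this is what \<open>defect_phase_eq_1\<close> asks
    for.\<close>
  then have "c * d1' = cnj d2'" using cc' by (simp add: mult.assoc[symmetric])
  then have "c = 1"
    by (rule M.defect_phase_eq_1[OF Im'(3,4) def d' _ R(3)[OF Im(1) r(2)] R(3)[OF Im(2) r(3)]])
  \<comment> \<open>Two conjugate values that both lie in the closed upper half-plane are real and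
    equal.\<close>
  then have "d1 = cnj d2" using d1 by simp
  moreover have "0 \<le> Im d1"
    by (rule LIMSEQ_le_const[OF tendsto_Im[OF d(1)]]) (use Im'(1) less_imp_le in blast)
  moreover have "0 \<le> Im d2"
    by (rule LIMSEQ_le_const[OF tendsto_Im[OF d(2)]]) (use Im'(2) less_imp_le in blast)
  ultimately have "d1 = d2" by (simp add: complex_eq_iff)
  with ne show False ..
qed

text \<open>\<open>D\<close> and \<open>D'\<close> are bounded along the sequence, and so is each
  energy, because the product of the two is at most the square of \<open>norm z\<close> and the
  other one is at least k. Bolzano-Weierstrass for the quadruple then gives one common
  subsequence.\<close>

lemma convergent_subsequence:
  assumes Im: "\<And>n. Im (z n) > 0" and z: "z \<longlonglongrightarrow> complex_of_real x" and x: "x \<noteq> 0"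
  obtains s r d d' \<alpha> \<alpha>' where "strict_mono s" "r > 0" "\<And>n. r \<le> norm (z (s n))"
    "(\<lambda>n. D (z (s n))) \<longlonglongrightarrow> d" "(\<lambda>n. D' (z (s n))) \<longlonglongrightarrow> d'"
    "(\<lambda>n. M.energy (D' (z (s n)))) \<longlonglongrightarrow> \<alpha>" "(\<lambda>n. M'.energy (D (z (s n)))) \<longlonglongrightarrow> \<alpha>'"
proof -
  have z0: "z n \<noteq> 0" for n using Im[of n] by auto
  have "(\<lambda>n. inverse (z n)) \<longlonglongrightarrow> inverse (of_real x)" using x by (intro tendsto_inverse z) simp
  then have "Bseq (\<lambda>n. inverse (z n))" by (intro convergent_imp_Bseq convergentI)
  then obtain K where K: "K > 0" "\<And>n. norm (inverse (z n)) \<le> K" by (auto simp: Bseq_def)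
  \<comment> \<open>The inverses converge because x is nonzero, hence are bounded by K, so the
    sequence keeps distance 1 / K from 0.\<close>
  define r where "r = 1 / K"
  have r: "r > 0" "\<And>n. r \<le> norm (z n)"
  proof -
    show "r > 0" using K by (simp add: r_def)
    show "r \<le> norm (z n)" for n
      using K(2)[of n] K(1) z0[of n] unfolding r_def norm_inverse by (simp add: divide_simps mult.commute)
  qed
  have "Bseq z" using z by (intro convergent_imp_Bseq convergentI)
  then obtain B where B: "B > 0" "\<And>n. norm (z n) \<le> B" by (auto simp: Bseq_def)
  obtain k R where k: "k > 0" "R > 0" and R:
    "\<And>z. Im z > 0 \<Longrightarrow> r \<le> norm z \<Longrightarrow> norm (D z) \<le> R"
    "\<And>z. Im z > 0 \<Longrightarrow> r \<le> norm z \<Longrightarrow> norm (D' z) \<le> R"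
    and E: "\<And>z. Im z > 0 \<Longrightarrow> r \<le> norm z \<Longrightarrow> k \<le> M.energy (D' z)"
    "\<And>z. Im z > 0 \<Longrightarrow> r \<le> norm z \<Longrightarrow> k \<le> M'.energy (D z)"
    "\<And>z. Im z > 0 \<Longrightarrow> r \<le> norm z \<Longrightarrow> k \<le> M.moment (D' z)"
    by (rule energy_bounds[OF r(1)]) blast
  note E = E[OF Im r(2)]
  have prod: "M.energy (D' (z n)) * M'.energy (D (z n)) \<le> B\<^sup>2" for n
    using energy_mult_le[OF Im[of n]] power_mono[OF B(2)[of n], of 2] by simp
  have E1: "norm (M.energy (D' (z n))) \<le> B\<^sup>2 / k" for n
  proof -
    have "M.energy (D' (z n)) * k \<le> M.energy (D' (z n)) * M'.energy (D (z n))"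
      using E k by (intro mult_left_mono) (auto intro: order_trans[of 0 k])
    then have "M.energy (D' (z n)) * k \<le> B\<^sup>2" using prod[of n] by linarith
    then show ?thesis using k E(1)[of n] by (simp add: pos_le_divide_eq)
  qed
  have E2: "norm (M'.energy (D (z n))) \<le> B\<^sup>2 / k" for n
  proof -
    have "k * M'.energy (D (z n)) \<le> M.energy (D' (z n)) * M'.energy (D (z n))"
      using E k by (intro mult_right_mono) (auto intro: order_trans[of 0 k])
    then have "M'.energy (D (z n)) * k \<le> B\<^sup>2" using prod[of n] by (simp add: mult.commute)
    then show ?thesis using k E(2)[of n] by (simp add: pos_le_divide_eq)
  qed
  let ?X = "\<lambda>n. ((D (z n), D' (z n)), (M.energy (D' (z n)), M'.energy (D (z n))))"
  have "range ?X \<subseteq> (cball 0 R \<times> cball 0 R) \<times> (cball 0 (B\<^sup>2 / k) \<times> cball 0 (B\<^sup>2 / k))"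
    using R[OF Im r(2)] E1 E2 by auto
  then have "bounded (range ?X)"
    by (rule bounded_subset[rotated]) (intro bounded_Times bounded_cball)
  then have "\<exists>l s. strict_mono s \<and> (?X \<circ> s) \<longlonglongrightarrow> l"
    by (rule bounded_imp_convergent_subsequence)
  then obtain l s where s: "strict_mono s" "(?X \<circ> s) \<longlonglongrightarrow> l" by blast
  show ?thesis
  proof (rule that[OF s(1) r(1) r(2)])
    note l = tendsto_fst[OF s(2)] tendsto_snd[OF s(2)]
    show "(\<lambda>n. D (z (s n))) \<longlonglongrightarrow> fst (fst l)" "(\<lambda>n. D' (z (s n))) \<longlonglongrightarrow> snd (fst l)"
      using tendsto_fst[OF l(1)] tendsto_snd[OF l(1)] by (simp_all add: o_def)
    show "(\<lambda>n. M.energy (D' (z (s n)))) \<longlonglongrightarrow> fst (snd l)" "(\<lambda>n. M'.energy (D (z (s n)))) \<longlonglongrightarrow> snd (snd l)"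
      using tendsto_fst[OF l(2)] tendsto_snd[OF l(2)] by (simp_all add: o_def)
  qed
qed

text \<open>The candidate d is a cluster value along the vertical. If \<open>D\<close> failed to
  converge to d along some sequence, a subsequence would stay e away from d, yet a further
  subsequence has a cluster value, which equals d by \<open>cluster_value_unique\<close>.\<close>

lemma D_boundary_limit:
  assumes x: "x \<noteq> 0"
  shows "\<exists>L. (D \<longlongrightarrow> L) (at (complex_of_real x) within upper_half)"
proof -
  define y where "y n = Complex x (inverse (real (Suc n)))" for n
  have Im_y: "Im (y n) > 0" for n by (simp add: y_def)
  have "y \<longlonglongrightarrow> Complex x 0"
    unfolding y_def by (intro tendsto_Complex tendsto_const LIMSEQ_inverse_real_of_nat)
  then have y: "y \<longlonglongrightarrow> of_real x" by (simp add: complex_of_real_def)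
  obtain s r d d' \<alpha> \<alpha>' where s: "strict_mono s" "r > 0" "\<And>n. r \<le> norm (y (s n))"
    "(\<lambda>n. D (y (s n))) \<longlonglongrightarrow> d" "(\<lambda>n. D' (y (s n))) \<longlonglongrightarrow> d'"
    "(\<lambda>n. M.energy (D' (y (s n)))) \<longlonglongrightarrow> \<alpha>" "(\<lambda>n. M'.energy (D (y (s n)))) \<longlonglongrightarrow> \<alpha>'"
    by (rule convergent_subsequence[OF Im_y y x]) blast
  have "(D \<longlongrightarrow> d) (at (complex_of_real x) within upper_half)"
    unfolding tendsto_at_iff_sequentially
  proof (intro allI impI)
    fix X assume X: "\<forall>i. X i \<in> upper_half - {complex_of_real x}" "X \<longlonglongrightarrow> of_real x"
    then have Im_X: "Im (X n) > 0" for n by (auto simp: upper_half_def)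
    show "(D \<circ> X) \<longlonglongrightarrow> d"
    proof (rule ccontr)
      assume "\<not> (D \<circ> X) \<longlonglongrightarrow> d"
      then obtain e where e: "e > 0" "\<forall>N. \<exists>n\<ge>N. \<not> dist ((D \<circ> X) n) d < e"
        unfolding lim_sequentially by blast
      then have "infinite {n. e \<le> dist (D (X n)) d}"
        unfolding infinite_nat_iff_unbounded_le by (simp add: not_less)
      then obtain q :: "nat \<Rightarrow> nat" where q: "strict_mono q" "\<And>n. q n \<in> {n. e \<le> dist (D (X n)) d}"
        using infinite_enumerate[of "{n. e \<le> dist (D (X n)) d}"] by blast
      have Xq: "(\<lambda>n. X (q n)) \<longlonglongrightarrow> of_real x"
        using LIMSEQ_subseq_LIMSEQ[OF X(2) q(1)] by (simp add: o_def)
      obtain s2 r2 d2 d2' \<alpha>2 \<alpha>2' where s2: "strict_mono s2" "r2 > 0" "\<And>n. r2 \<le> norm (X (q (s2 n)))"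
        "(\<lambda>n. D (X (q (s2 n)))) \<longlonglongrightarrow> d2" "(\<lambda>n. D' (X (q (s2 n)))) \<longlonglongrightarrow> d2'"
        "(\<lambda>n. M.energy (D' (X (q (s2 n))))) \<longlonglongrightarrow> \<alpha>2" "(\<lambda>n. M'.energy (D (X (q (s2 n))))) \<longlonglongrightarrow> \<alpha>2'"
        by (rule convergent_subsequence[of "\<lambda>n. X (q n)", OF Im_X Xq x]) blast
      have "d = d2"
      proof (rule cluster_value_unique[of "\<lambda>n. y (s n)" "\<lambda>n. X (q (s2 n))" x "min r r2"])
        show "(\<lambda>n. y (s n)) \<longlonglongrightarrow> of_real x" "(\<lambda>n. X (q (s2 n))) \<longlonglongrightarrow> of_real x"
          using LIMSEQ_subseq_LIMSEQ[OF y s(1)] LIMSEQ_subseq_LIMSEQ[OF Xq s2(1)] by (simp_all add: o_def)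
        show "min r r2 > 0" "\<And>n. min r r2 \<le> norm (y (s n))" "\<And>n. min r r2 \<le> norm (X (q (s2 n)))"
          using s(2,3) s2(2,3) by (auto simp: min_le_iff_disj)
      qed (fact Im_y Im_X x s(4-7) s2(4-7))+
      moreover have "e \<le> dist d2 d"
        by (rule LIMSEQ_le_const[OF tendsto_dist[OF s2(4) tendsto_const]]) (use q(2) in auto)
      ultimately show False using e(1) by simp
    qed
  qed
  then show ?thesis ..
qed

text \<open>The formulas for \<open>Im (z * D z)\<close>, \<open>Im (z * D' z)\<close> and
  \<open>Im (z * G z)\<close> pass to the limit along the vertical once energies and moment are
  replaced by their lower bounds. \<open>G\<close> stands for m, with q equal to 1 / c.\<close>

lemma Im_boundary_comparison:
  assumes x: "x \<noteq> 0"
    and D: "(D \<longlongrightarrow> d) (at (complex_of_real x) within upper_half)"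
    and D': "(D' \<longlongrightarrow> d') (at (complex_of_real x) within upper_half)"
    and G: "(G \<longlongrightarrow> l) (at (complex_of_real x) within upper_half)"
    and G_eq: "\<And>z. Im z > 0 \<Longrightarrow> Im (z * G z) = q * M.moment (D' z) * Im (D' z)" and q: "q > 0"
  obtains k where "k > 0" "k * Im d' \<le> x * Im d" "k * Im d \<le> x * Im d'" "k * Im d' \<le> x * Im l"
proof -
  let ?z = "\<lambda>n. Complex x (inverse (real (Suc n)))"
  \<comment> \<open>On the vertical through x the norm of z is at least |x|, so |x| is an admissible
    radius for \<open>energy_bounds\<close>.\<close>
  have r: "\<bar>x\<bar> > 0" using x by simp
  obtain k R where k: "k > 0" "R > 0"
    "\<And>z. Im z > 0 \<Longrightarrow> \<bar>x\<bar> \<le> norm z \<Longrightarrow> norm (D z) \<le> R"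
    "\<And>z. Im z > 0 \<Longrightarrow> \<bar>x\<bar> \<le> norm z \<Longrightarrow> norm (D' z) \<le> R"
    "\<And>z. Im z > 0 \<Longrightarrow> \<bar>x\<bar> \<le> norm z \<Longrightarrow> k \<le> M.energy (D' z)"
    "\<And>z. Im z > 0 \<Longrightarrow> \<bar>x\<bar> \<le> norm z \<Longrightarrow> k \<le> M'.energy (D z)"
    "\<And>z. Im z > 0 \<Longrightarrow> \<bar>x\<bar> \<le> norm z \<Longrightarrow> k \<le> M.moment (D' z)"
    by (rule energy_bounds[OF r]) blast
  have z: "Im (?z n) > 0" "\<bar>x\<bar> \<le> norm (?z n)" for n
    using abs_Re_le_cmod[of "?z n"] by simp_all
  note lim = tendsto_along_upper_half[OF D z(1) tendsto_Complex_vertical]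
    tendsto_along_upper_half[OF D' z(1) tendsto_Complex_vertical]
    tendsto_along_upper_half[OF G z(1) tendsto_Complex_vertical]
  have le: "p * Im u' \<le> x * Im u"
    if "\<And>n. p * Im (g' (?z n)) \<le> Im (?z n * g (?z n))"
      "(\<lambda>n. g (?z n)) \<longlonglongrightarrow> u" "(\<lambda>n. g' (?z n)) \<longlonglongrightarrow> u'" for g g' u u' p
  proof -
    have "(\<lambda>n. Im (?z n * g (?z n))) \<longlonglongrightarrow> Im (of_real x * u)"
      by (intro tendsto_intros tendsto_Complex_vertical that)
    moreover have "(\<lambda>n. p * Im (g' (?z n))) \<longlonglongrightarrow> p * Im u'" by (intro tendsto_intros that)
    ultimately have "p * Im u' \<le> Im (of_real x * u)" using that(1) by (intro LIMSEQ_le) auto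
    then show ?thesis by simp
  qed
  have "k * Im d' \<le> x * Im d"
  proof (rule le[OF _ lim(1,2)])
    show "k * Im (D' (?z n)) \<le> Im (?z n * D (?z n))" for n
      unfolding Im_mult_D[OF z(1)] using k(5)[OF z] Im_D'[OF z(1)] by (intro mult_right_mono) (auto intro: less_imp_le)
  qed
  moreover have "k * Im d \<le> x * Im d'"
  proof (rule le[OF _ lim(2,1)])
    show "k * Im (D (?z n)) \<le> Im (?z n * D' (?z n))" for n
      unfolding Im_mult_D'[OF z(1)] using k(6)[OF z] Im_D[OF z(1)] by (intro mult_right_mono) (auto intro: less_imp_le)
  qed
  moreover have "q * k * Im d' \<le> x * Im l"
  proof (rule le[OF _ lim(3,2)])
    show "q * k * Im (D' (?z n)) \<le> Im (?z n * G (?z n))" for n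
      unfolding G_eq[OF z(1)] using k(7)[OF z] Im_D'[OF z(1)] q
      by (intro mult_right_mono mult_left_mono) (auto intro: less_imp_le)
  qed
  moreover have "0 \<le> Im d" "0 \<le> Im d'"
    using Im_D[OF z(1)] Im_D'[OF z(1)]
    by (intro LIMSEQ_le_const[OF tendsto_Im[OF lim(1)]] LIMSEQ_le_const[OF tendsto_Im[OF lim(2)]];
        auto intro: less_imp_le)+
  \<comment> \<open>As the imaginary parts are nonnegative, the smaller of \<open>k\<close> and
    \<open>q * k\<close> serves in all three inequalities.\<close>
  then have "min k (q * k) * Im d' \<le> k * Im d'" "min k (q * k) * Im d \<le> k * Im d"
      "min k (q * k) * Im d' \<le> q * k * Im d'"
    by (auto intro!: mult_right_mono)
  moreover have "min k (q * k) > 0" using k q by simp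
  ultimately show ?thesis by (intro that[of "min k (q * k)"]) linarith+
qed

end

section \<open>From the given measures to the coupled system\<close>

lemma half_line_measure_scaled:
  fixes c :: real
  assumes c: "c > 0" and nu: "prob_space \<nu>" "sets \<nu> = sets borel" "emeasure \<nu> {..<0} = 0" "\<nu> \<noteq> return borel 0"
  shows "half_line_measure (density \<nu> (\<lambda>_. ennreal c))"
proof -
  interpret prob_space \<nu> by fact
  note [simp, measurable_cong] = nu(2)
  have [simp]: "space \<nu> = UNIV" using sets_eq_imp_space_eq[OF nu(2)] by simp
  have em: "emeasure (density \<nu> (\<lambda>_. ennreal c)) A = ennreal c * emeasure \<nu> A" if "A \<in> sets borel" for A
    using that by (simp add: emeasure_density_const)
  have AE: "AE t in \<nu>. 0 \<le> t"
    using nu(3) by (subst AE_iff_measurable[of "{..<0}"]) (auto simp: not_le)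
  \<comment> \<open>Without mass on the open half-line the measure would be concentrated at 0, hence
    be the excluded Dirac mass.\<close>
  have pos: "emeasure \<nu> {0<..} \<noteq> 0"
  proof
    assume null: "emeasure \<nu> {0<..} = 0"
    have "AE t in \<nu>. t \<notin> {0<..}" using null by (intro AE_not_in) (auto simp: null_sets_def)
    with AE have AE0: "AE t in \<nu>. t = 0" by eventually_elim auto
    have "\<nu> = return borel 0"
    proof (rule measure_eqI)
      fix A assume A: "A \<in> sets \<nu>"
      show "emeasure \<nu> A = emeasure (return borel 0) A"
      proof (cases "0 \<in> A")
        case True
        from AE0 have "AE t in \<nu>. t \<in> A" by eventually_elim (use True in auto)
        then have "emeasure \<nu> A = 1" using A by (intro emeasure_eq_1_AE) auto
        then show ?thesis using True A by simp
      next
        case False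
        from AE0 have "AE t in \<nu>. t \<notin> A" by eventually_elim (use False in auto)
        then have "emeasure \<nu> A = 0" using A by (subst (asm) AE_iff_measurable[of A]) auto
        then show ?thesis using False A by simp
      qed
    qed simp
    with nu(4) show False ..
  qed
  show ?thesis
  proof (intro half_line_measure.intro half_line_measure_axioms.intro finite_measureI)
    show "emeasure (density \<nu> (\<lambda>_. ennreal c)) (space (density \<nu> (\<lambda>_. ennreal c))) \<noteq> \<infinity>"
      by (simp add: em ennreal_mult_eq_top_iff)
    show "AE t in density \<nu> (\<lambda>_. ennreal c). 0 \<le> t" using AE by (simp add: AE_density)
    show "emeasure (density \<nu> (\<lambda>_. ennreal c)) {0<..} \<noteq> 0" using pos c by (simp add: em)
  qed simp
qed

text \<open>On the half-line the weights 1 / (1 + t) and 1 / (1 + |t|) agree almost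
  everywhere.\<close>

lemma stieltjes_transformI:
  assumes "sets M = sets borel" "emeasure M {..<0} = 0" "\<forall>K. compact K \<longrightarrow> emeasure M K < \<infinity>"
    "(\<integral>\<^sup>+ t. ennreal (1 / (1 + t)) \<partial>M) < \<infinity>"
    "\<forall>z\<in>upper_half. f z = (\<integral>t. 1 / (complex_of_real t - z) \<partial>M)"
  shows "stieltjes_transform M f"
proof
  note [simp, measurable_cong] = assms(1)
  have [simp]: "space M = UNIV" using sets_eq_imp_space_eq[OF assms(1)] by simp
  have AE: "AE t in M. 0 \<le> t"
    using assms(2) by (subst AE_iff_measurable[of "{..<0}"]) (auto simp: not_le)
  have "(\<integral>\<^sup>+ t. ennreal (norm (1 / (1 + \<bar>t\<bar>))) \<partial>M) = (\<integral>\<^sup>+ t. ennreal (1 / (1 + t)) \<partial>M)"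
    by (intro nn_integral_cong_AE) (use AE in eventually_elim, simp)
  then show "integrable M (\<lambda>t. 1 / (1 + \<bar>t\<bar>))" using assms(4) by (intro integrableI_bounded) auto
qed (use assms in \<open>auto simp: upper_half_def\<close>)

lemma integral_scaled:
  fixes f :: "real \<Rightarrow> complex"
  assumes "c > 0" "sets \<nu> = sets borel" "f \<in> borel_measurable borel"
  shows "(\<integral>t. f t \<partial>density \<nu> (\<lambda>_. ennreal c)) = of_real c * (\<integral>t. f t \<partial>\<nu>)"
proof -
  have "f \<in> borel_measurable \<nu>" using assms by simp
  then have "(\<integral>t. f t \<partial>density \<nu> (\<lambda>_. ennreal c)) = (\<integral>t. c *\<^sub>R f t \<partial>\<nu>)"
    using assms(1) by (intro integral_density) auto
  then show ?thesis by (simp add: scaleR_conv_of_real)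
qed

theorem theorem3p1:
  fixes c :: real and \<nu> \<nu>' \<mu> \<rho> \<rho>' :: "real measure"
    and \<delta> \<delta>' m :: "complex \<Rightarrow> complex"
  assumes c_pos: "c > 0"
    and nu: "prob_space \<nu>" "sets \<nu> = sets borel" "emeasure \<nu> {..<0} = 0" "\<nu> \<noteq> return borel 0"
    and nu': "prob_space \<nu>'" "sets \<nu>' = sets borel" "emeasure \<nu>' {..<0} = 0" "\<nu>' \<noteq> return borel 0"
    and delta_in: "\<forall>z\<in>upper_half. \<delta> z \<in> upper_half \<and> \<delta>' z \<in> upper_half"
    and delta_eq: "\<forall>z\<in>upper_half. \<delta> z =
        complex_of_real c * (\<integral>t. complex_of_real t / (- z * (1 + \<delta>' z * complex_of_real t)) \<partial>\<nu>)"
    and delta'_eq: "\<forall>z\<in>upper_half. \<delta>' z =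
        (\<integral>t. complex_of_real t / (- z * (1 + \<delta> z * complex_of_real t)) \<partial>\<nu>')"
    and m_eq: "\<forall>z\<in>upper_half. m z = (\<integral>t. 1 / (- z * (1 + \<delta>' z * complex_of_real t)) \<partial>\<nu>)"
    and mu: "prob_space \<mu>" "sets \<mu> = sets borel" "emeasure \<mu> {..<0} = 0"
        "\<forall>z\<in>upper_half. m z = (\<integral>t. 1 / (complex_of_real t - z) \<partial>\<mu>)"
    and rho: "sets \<rho> = sets borel" "emeasure \<rho> {..<0} = 0"
        "\<forall>K. compact K \<longrightarrow> emeasure \<rho> K < \<infinity>"
        "0 < (\<integral>\<^sup>+ t. ennreal (1 / (1 + t)) \<partial>\<rho>)" "(\<integral>\<^sup>+ t. ennreal (1 / (1 + t)) \<partial>\<rho>) < \<infinity>"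
        "\<forall>z\<in>upper_half. \<delta> z = (\<integral>t. 1 / (complex_of_real t - z) \<partial>\<rho>)"
    and rho': "sets \<rho>' = sets borel" "emeasure \<rho>' {..<0} = 0"
        "\<forall>K. compact K \<longrightarrow> emeasure \<rho>' K < \<infinity>"
        "0 < (\<integral>\<^sup>+ t. ennreal (1 / (1 + t)) \<partial>\<rho>')" "(\<integral>\<^sup>+ t. ennreal (1 / (1 + t)) \<partial>\<rho>') < \<infinity>"
        "\<forall>z\<in>upper_half. \<delta>' z = (\<integral>t. 1 / (complex_of_real t - z) \<partial>\<rho>')"
  shows "(\<forall>x::real. x \<noteq> 0 \<longrightarrow> (\<exists>L. (m \<longlongrightarrow> L) (at (complex_of_real x) within upper_half)))
    \<and> continuous_on (- {0}) (\<lambda>x. Im (bval m x))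
    \<and> has_density_on \<mu> (- {0}) (\<lambda>x. Im (bval m x) / pi)
    \<and> (\<forall>x::real. x \<noteq> 0 \<longrightarrow> (\<exists>L. (\<delta> \<longlongrightarrow> L) (at (complex_of_real x) within upper_half)))
    \<and> (\<forall>x::real. x \<noteq> 0 \<longrightarrow> (\<exists>L. (\<delta>' \<longlongrightarrow> L) (at (complex_of_real x) within upper_half)))
    \<and> continuous_on (- {0}) (\<lambda>x. Im (bval \<delta> x))
    \<and> continuous_on (- {0}) (\<lambda>x. Im (bval \<delta>' x))
    \<and> (\<exists>g. continuous_on (- {0}) g \<and> has_density_on \<rho> (- {0}) g)
    \<and> (\<exists>g. continuous_on (- {0}) g \<and> has_density_on \<rho>' (- {0}) g)
    \<and> msupport \<rho> \<inter> (- {0}) = msupport \<mu> \<inter> (- {0})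
    \<and> msupport \<rho>' \<inter> (- {0}) = msupport \<mu> \<inter> (- {0})"
proof -
  \<comment> \<open>The constant c goes into the first measure; the second is written with density 1
    so that \<open>half_line_measure_scaled\<close> covers both.\<close>
  let ?M = "density \<nu> (\<lambda>_. ennreal c)" and ?M' = "density \<nu>' (\<lambda>_. ennreal 1)"
  have fraction: "of_real t / (- z * (1 + d * of_real t)) = - (1 / z) * resolvent d t" for z d t
    by (simp add: resolvent_def)
  interpret hl: half_line_measure ?M by (rule half_line_measure_scaled[OF c_pos nu])
  interpret hl': half_line_measure ?M' by (rule half_line_measure_scaled[OF zero_less_one nu'])
  interpret S: coupled_system ?M ?M' \<delta> \<delta>'
  proof
    fix z :: complex assume z: "Im z > 0"
    then have zu: "z \<in> upper_half" and z0: "z \<noteq> 0" by (auto simp: upper_half_def)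
    show "0 < Im (\<delta> z)" "0 < Im (\<delta>' z)" using delta_in zu by (auto simp: upper_half_def)
    have "\<delta> z = of_real c * (\<integral>t. - (1 / z) * resolvent (\<delta>' z) t \<partial>\<nu>)"
      using delta_eq zu by (simp only: fraction)
    also have "\<dots> = - (1 / z) * (of_real c * (\<integral>t. resolvent (\<delta>' z) t \<partial>\<nu>))"
      by (simp only: integral_mult_right_zero mult.left_commute)
    also have "of_real c * (\<integral>t. resolvent (\<delta>' z) t \<partial>\<nu>) = (\<integral>t. resolvent (\<delta>' z) t \<partial>?M)"
      using c_pos nu(2) by (simp add: integral_scaled)
    finally have "z * \<delta> z = z * (- (1 / z) * (\<integral>t. resolvent (\<delta>' z) t \<partial>?M))" by (rule arg_cong)
    also have "\<dots> = - (\<integral>t. resolvent (\<delta>' z) t \<partial>?M)" using z0 by simp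
    finally show "z * \<delta> z = - (\<integral>t. resolvent (\<delta>' z) t \<partial>?M)" .
    have "\<delta>' z = (\<integral>t. - (1 / z) * resolvent (\<delta> z) t \<partial>\<nu>')"
      using delta'_eq zu by (simp only: fraction)
    also have "\<dots> = - (1 / z) * (of_real 1 * (\<integral>t. resolvent (\<delta> z) t \<partial>\<nu>'))"
      by (simp only: integral_mult_right_zero of_real_1 mult_1_left)
    also have "of_real 1 * (\<integral>t. resolvent (\<delta> z) t \<partial>\<nu>') = (\<integral>t. resolvent (\<delta> z) t \<partial>?M')"
      by (rule integral_scaled[symmetric]) (simp_all add: nu'(2))
    finally have "z * \<delta>' z = z * (- (1 / z) * (\<integral>t. resolvent (\<delta> z) t \<partial>?M'))" by (rule arg_cong)
    also have "\<dots> = - (\<integral>t. resolvent (\<delta> z) t \<partial>?M')" using z0 by simp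
    finally show "z * \<delta>' z = - (\<integral>t. resolvent (\<delta> z) t \<partial>?M')" .
  qed
  \<comment> \<open>The identity 1 / (1 + d t) = 1 - d t / (1 + d t) turns the integral for m into
    the total mass 1 and a resolvent integral; division by c undoes the scaling of
    \<open>?M\<close>.\<close>
  have zm: "z * m z = - 1 + \<delta>' z * (\<integral>t. resolvent (\<delta>' z) t \<partial>?M) / of_real c" if z: "Im z > 0" for z
  proof -
    interpret P: prob_space \<nu> by (rule nu(1))
    have z0: "z \<noteq> 0" using z by auto
    have "Im (\<delta>' z) > 0" by (rule S.Im_D'[OF z])
    note nz = one_plus_mult_nonzero[OF this]
    have int: "integrable \<nu> (resolvent (\<delta>' z))"
      by (rule P.integrable_const_bound[of _ "1 / Im (\<delta>' z)"])
        (use norm_resolvent_le[OF S.Im_D'[OF z]] nu(2) in auto)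
    have "1 / (- z * (1 + \<delta>' z * of_real t)) = - (1 / z) * (1 - \<delta>' z * resolvent (\<delta>' z) t)" for t
    proof -
      have "1 - \<delta>' z * resolvent (\<delta>' z) t = 1 / (1 + \<delta>' z * of_real t)"
        using nz[of t] by (simp add: resolvent_def field_simps)
      then show ?thesis by simp
    qed
    then have "m z = (\<integral>t. - (1 / z) * (1 - \<delta>' z * resolvent (\<delta>' z) t) \<partial>\<nu>)"
      using m_eq z by (simp only: upper_half_def mem_Collect_eq)
    also have "\<dots> = - (1 / z) * (\<integral>t. 1 - \<delta>' z * resolvent (\<delta>' z) t \<partial>\<nu>)"
      by (rule integral_mult_right_zero)
    also have "(\<integral>t. 1 - \<delta>' z * resolvent (\<delta>' z) t \<partial>\<nu>) = 1 - \<delta>' z * (\<integral>t. resolvent (\<delta>' z) t \<partial>\<nu>)"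
      using int by (simp add: P.prob_space)
    finally have "z * m z = - 1 + \<delta>' z * (\<integral>t. resolvent (\<delta>' z) t \<partial>\<nu>)"
      using z0 by simp
    moreover have "(\<integral>t. resolvent (\<delta>' z) t \<partial>?M) = of_real c * (\<integral>t. resolvent (\<delta>' z) t \<partial>\<nu>)"
      using c_pos nu(2) by (simp add: integral_scaled)
    ultimately show ?thesis using c_pos by simp
  qed
  have m_formula: "m z = - 1 / z - \<delta> z * \<delta>' z / of_real c" if z: "Im z > 0" for z
  proof -
    have z0: "z \<noteq> 0" using z by auto
    have "z * m z = - 1 - \<delta>' z * (z * \<delta> z) / of_real c" unfolding zm[OF z] S.D_eq[OF z] by simp
    then show ?thesis using z0 c_pos by (simp add: field_simps)
  qed
  \<comment> \<open>Multiplied by \<open>\<delta>' z\<close>, the energy term of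
    \<open>integral_resolvent_eq\<close> becomes real, so only the moment term contributes.\<close>
  have Im_zm: "Im (z * m z) = 1 / c * hl.moment (\<delta>' z) * Im (\<delta>' z)" if z: "Im z > 0" for z
    unfolding zm[OF z] hl.integral_resolvent_eq[OF S.Im_D'[OF z]]
    by (simp add: add_divide_distrib algebra_simps)

  have lim_ex: "\<exists>L. (\<delta> \<longlongrightarrow> L) (at (complex_of_real x) within upper_half)"
    "\<exists>L. (\<delta>' \<longlongrightarrow> L) (at (complex_of_real x) within upper_half)" if "x \<noteq> 0" for x
    by (rule S.D_boundary_limit[OF that], rule coupled_system.D_boundary_limit[OF S.swap that])
  note lim = tendsto_bval[OF lim_ex(1)] tendsto_bval[OF lim_ex(2)]
  have m_lim: "(m \<longlongrightarrow> - 1 / of_real x - bval \<delta> x * bval \<delta>' x / of_real c) (at (complex_of_real x) within upper_half)"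
    if x: "x \<noteq> 0" for x
  proof (rule Lim_transform_eventually)
    show "((\<lambda>z. - 1 / z - \<delta> z * \<delta>' z / of_real c) \<longlongrightarrow> - 1 / of_real x - bval \<delta> x * bval \<delta>' x / of_real c)
        (at (complex_of_real x) within upper_half)"
      using x c_pos by (intro tendsto_intros lim) auto
    show "\<forall>\<^sub>F z in at (complex_of_real x) within upper_half. - 1 / z - \<delta> z * \<delta>' z / of_real c = m z"
      unfolding eventually_at_filter by (intro always_eventually) (simp add: upper_half_def m_formula)
  qed
  then have m_ex: "\<exists>L. (m \<longlongrightarrow> L) (at (complex_of_real x) within upper_half)" if "x \<noteq> 0" for x
    using that by blast
  note m_bval = tendsto_bval[OF m_ex]
  have m_val: "bval m x = - 1 / of_real x - bval \<delta> x * bval \<delta>' x / of_real c" if x: "x \<noteq> 0" for x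
    by (rule tendsto_unique[OF at_within_upper_half_nontrivial m_bval[OF x] m_lim[OF x]])

  have open0: "open (- {0 :: real})" by auto
  have cont: "continuous_on (- {0}) (\<lambda>x. Im (bval \<delta> x))" "continuous_on (- {0}) (\<lambda>x. Im (bval \<delta>' x))"
    "continuous_on (- {0}) (\<lambda>x. Im (bval m x))"
    by (rule continuous_on_Im continuous_on_boundary_values lim m_bval | simp)+
  have cont_pi: "continuous_on (- {0}) (\<lambda>x. Im (bval \<delta> x) / pi)" "continuous_on (- {0}) (\<lambda>x. Im (bval \<delta>' x) / pi)"
    "continuous_on (- {0}) (\<lambda>x. Im (bval m x) / pi)"
    using cont by (auto intro!: continuous_intros)

  interpret R: stieltjes_transform \<rho> \<delta> by (rule stieltjes_transformI[OF rho(1,2,3,5,6)])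
  interpret R': stieltjes_transform \<rho>' \<delta>' by (rule stieltjes_transformI[OF rho'(1,2,3,5,6)])
  interpret Mu: stieltjes_transform \<mu> m
  proof (rule stieltjes_transformI[OF mu(2,3) _ _ mu(4)])
    interpret P: prob_space \<mu> by (rule mu(1))
    show "\<forall>K. compact K \<longrightarrow> emeasure \<mu> K < \<infinity>" by (simp add: P.emeasure_finite less_top[symmetric])
    have "AE t in \<mu>. 0 \<le> t"
      using mu(2,3) sets_eq_imp_space_eq[OF mu(2)] by (subst AE_iff_measurable[of "{..<0}"]) (auto simp: not_le)
    then have "AE t in \<mu>. ennreal (1 / (1 + t)) \<le> 1"
      by eventually_elim (simp add: divide_le_eq flip: ennreal_1)
    then have "(\<integral>\<^sup>+ t. ennreal (1 / (1 + t)) \<partial>\<mu>) \<le> (\<integral>\<^sup>+ t. 1 \<partial>\<mu>)" by (rule nn_integral_mono_AE)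
    also have "\<dots> < \<infinity>" by (simp add: P.emeasure_space_1)
    finally show "(\<integral>\<^sup>+ t. ennreal (1 / (1 + t)) \<partial>\<mu>) < \<infinity>" .
  qed
  have dens: "has_density_on \<rho> (- {0}) (\<lambda>x. Im (bval \<delta> x) / pi)" "has_density_on \<rho>' (- {0}) (\<lambda>x. Im (bval \<delta>' x) / pi)"
    "has_density_on \<mu> (- {0}) (\<lambda>x. Im (bval m x) / pi)"
    by (rule R.has_density_on_boundary[OF open0] R'.has_density_on_boundary[OF open0] Mu.has_density_on_boundary[OF open0],
        rule lim m_bval, simp)+

  \<comment> \<open>If the imaginary part of \<open>bval \<delta>' x\<close> vanishes, so does that
    of \<open>bval \<delta> x\<close>, and \<open>m_val\<close> makes \<open>bval m x\<close> real.
    Otherwise the comparison makes x times the other two imaginary parts positive, so neither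
    vanishes.\<close>
  have pos_iff: "(Im (bval \<delta> x) > 0 \<longleftrightarrow> Im (bval m x) > 0) \<and> (Im (bval \<delta>' x) > 0 \<longleftrightarrow> Im (bval m x) > 0)"
    if x: "x \<noteq> 0" for x
  proof -
    obtain k where k: "k > 0" "k * Im (bval \<delta>' x) \<le> x * Im (bval \<delta> x)" "k * Im (bval \<delta> x) \<le> x * Im (bval \<delta>' x)"
      "k * Im (bval \<delta>' x) \<le> x * Im (bval m x)"
      by (rule S.Im_boundary_comparison[OF x lim(1)[OF x] lim(2)[OF x] m_bval[OF x] Im_zm]) (use c_pos in auto)
    have nonneg: "0 \<le> Im (bval \<delta> x)" "0 \<le> Im (bval \<delta>' x)" "0 \<le> Im (bval m x)"
      by (rule R.Im_boundary_nonneg[OF lim(1)[OF x]] R'.Im_boundary_nonneg[OF lim(2)[OF x]]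
          Mu.Im_boundary_nonneg[OF m_bval[OF x]])+
    show ?thesis
    proof (cases "Im (bval \<delta>' x) = 0")
      case True
      then have "k * Im (bval \<delta> x) \<le> 0" using k(3) by simp
      then have "Im (bval \<delta> x) = 0" using k(1) nonneg(1) by (simp add: mult_le_0_iff)
      then show ?thesis using True by (simp add: m_val[OF x] Im_divide)
    next
      case False
      then have "0 < k * Im (bval \<delta>' x)" using k(1) nonneg(2) by simp
      then have "0 < x * Im (bval \<delta> x)" "0 < x * Im (bval m x)" using k(2,4) by linarith+
      then have "Im (bval \<delta> x) \<noteq> 0" "Im (bval m x) \<noteq> 0" by auto
      then show ?thesis using False nonneg by auto
    qed
  qed
  have supp: "msupport \<rho> \<inter> (- {0}) = msupport \<mu> \<inter> (- {0})" "msupport \<rho>' \<inter> (- {0}) = msupport \<mu> \<inter> (- {0})"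
  proof -
    \<comment> \<open>The three densities are positive at the same nonzero points, so the criterion
      of \<open>msupport_density_iff\<close> is the same for all three measures.\<close>
    have "x \<in> msupport \<rho> \<longleftrightarrow> x \<in> msupport \<mu>" "x \<in> msupport \<rho>' \<longleftrightarrow> x \<in> msupport \<mu>" if "x \<in> - {0}" for x
      unfolding msupport_density_iff[OF dens(1) cont_pi(1) open0 that rho(1)]
        msupport_density_iff[OF dens(2) cont_pi(2) open0 that rho'(1)]
        msupport_density_iff[OF dens(3) cont_pi(3) open0 that mu(2)]
      by (intro all_cong bex_cong refl; simp add: zero_less_divide_iff pos_iff)+
    then show "msupport \<rho> \<inter> (- {0}) = msupport \<mu> \<inter> (- {0})" "msupport \<rho>' \<inter> (- {0}) = msupport \<mu> \<inter> (- {0})"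
      by blast+
  qed
  show ?thesis
    using m_ex lim_ex cont dens supp cont_pi by blast
qed

end
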